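(* Let $n\ge 1$. If $X\subseteq\mathbb{R}^n$ is $\langle \mathbb{R},+,<,\mathbb{Z}\rangle$-definable but not $\langle \mathbb{R},+,<,1\rangle$-definable, then the set $\mathbb{Z}$ is definable in $\langle \mathbb{R},+,<,1,X\rangle$.
   Context: Structures are one-sorted with domain $\mathbb{R}$ and formulas are first-order with equality. In $\langle \mathbb{R},+,<,\mathbb{Z}\rangle$, $\mathbb{Z}$ is a unary predicate satisfied exactly by the integers; in $\langle \mathbb{R},+,<,1\rangle$, $1$ is a constant; $\langle \mathbb{R},+,<,1,X\rangle$ is the expansion of the latter by an $n$-ary predicate for $X$. A relation $Y\subseteq\mathbb{R}^k$ is definable in a structure $\mathcal{M}$ ($\mathcal M$-definable) if there is a formula $\varphi(x_1,\dots,x_k)$ in the signature of $\mathcal{M}$ (no parameters) such that $\varphi(a_1,\dots,a_k)$ holds in $\mathcal M$ iff $(a_1,\dots,a_k)\in Y$. *)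

theory Defs
  imports Complex_Main
begin

datatype 'f trm = Var nat | Fn 'f "'f trm list"

datatype ('f, 'r) fm =
    Eq "'f trm" "'f trm"
  | Rel 'r "'f trm list"
  | Neg "('f, 'r) fm"
  | Conj "('f, 'r) fm" "('f, 'r) fm"
  | Ex nat "('f, 'r) fm"

definition tuples :: "nat \<Rightarrow> 'a list set" where
  "tuples k = {xs. length xs = k}"

text \<open>
  A structure carries its own signature: the symbols in the domains of the two partial maps,
  with the arity as first component of the value. The second component is the interpretation,
  of which only the values on lists of that length matter. Constants are function
  symbols of arity 0. The domain of the structure is the whole type \<^typ>\<open>'a\<close>.
\<close>

record ('f, 'r, 'a) fo_structure =
  fns :: "'f \<rightharpoonup> nat \<times> ('a list \<Rightarrow> 'a)"
  rels :: "'r \<rightharpoonup> nat \<times> 'a list set"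

fun wf_trm :: "('f, 'r, 'a) fo_structure \<Rightarrow> 'f trm \<Rightarrow> bool" where
  "wf_trm M (Var x) \<longleftrightarrow> True"
| "wf_trm M (Fn f ts) \<longleftrightarrow>
     map_option fst (fns M f) = Some (length ts) \<and> (\<forall>t\<in>set ts. wf_trm M t)"

fun wf_fm :: "('f, 'r, 'a) fo_structure \<Rightarrow> ('f, 'r) fm \<Rightarrow> bool" where
  "wf_fm M (Eq t u) \<longleftrightarrow> wf_trm M t \<and> wf_trm M u"
| "wf_fm M (Rel r ts) \<longleftrightarrow>
     map_option fst (rels M r) = Some (length ts) \<and> (\<forall>t\<in>set ts. wf_trm M t)"
| "wf_fm M (Neg \<phi>) \<longleftrightarrow> wf_fm M \<phi>"
| "wf_fm M (Conj \<phi> \<psi>) \<longleftrightarrow> wf_fm M \<phi> \<and> wf_fm M \<psi>"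
| "wf_fm M (Ex x \<phi>) \<longleftrightarrow> wf_fm M \<phi>"

fun vars_trm :: "'f trm \<Rightarrow> nat set" where
  "vars_trm (Var x) = {x}"
| "vars_trm (Fn f ts) = (\<Union>t\<in>set ts. vars_trm t)"

fun free_vars :: "('f, 'r) fm \<Rightarrow> nat set" where
  "free_vars (Eq t u) = vars_trm t \<union> vars_trm u"
| "free_vars (Rel r ts) = (\<Union>t\<in>set ts. vars_trm t)"
| "free_vars (Neg \<phi>) = free_vars \<phi>"
| "free_vars (Conj \<phi> \<psi>) = free_vars \<phi> \<union> free_vars \<psi>"
| "free_vars (Ex x \<phi>) = free_vars \<phi> - {x}"

fun val :: "('f, 'r, 'a) fo_structure \<Rightarrow> (nat \<Rightarrow> 'a) \<Rightarrow> 'f trm \<Rightarrow> 'a" where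
  "val M s (Var x) = s x"
| "val M s (Fn f ts) = snd (the (fns M f)) (map (val M s) ts)"

fun sat :: "('f, 'r, 'a) fo_structure \<Rightarrow> (nat \<Rightarrow> 'a) \<Rightarrow> ('f, 'r) fm \<Rightarrow> bool" where
  "sat M s (Eq t u) \<longleftrightarrow> val M s t = val M s u"
| "sat M s (Rel r ts) \<longleftrightarrow> map (val M s) ts \<in> snd (the (rels M r))"
| "sat M s (Neg \<phi>) \<longleftrightarrow> \<not> sat M s \<phi>"
| "sat M s (Conj \<phi> \<psi>) \<longleftrightarrow> sat M s \<phi> \<and> sat M s \<psi>"
| "sat M s (Ex x \<phi>) \<longleftrightarrow> (\<exists>a. sat M (s(x := a)) \<phi>)"

text \<open>
  Definability without parameters; the variables \<open>x\<^sub>1, \<dots>, x\<^sub>k\<close> are the variables with indices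
  \<open>0, \<dots>, k - 1\<close>. All values of the other variables are irrelevant, as these are not free.
\<close>

definition definable :: "('f, 'r, 'a) fo_structure \<Rightarrow> nat \<Rightarrow> 'a list set \<Rightarrow> bool" where
  "definable M k Y \<longleftrightarrow> Y \<subseteq> tuples k \<and>
     (\<exists>\<phi>. wf_fm M \<phi> \<and> free_vars \<phi> \<subseteq> {..<k} \<and>
        (\<forall>s. sat M s \<phi> \<longleftrightarrow> map s [0..<k] \<in> Y))"

datatype fsym = Plus | One
datatype rsym = Less | IntPred | SetPred

definition plus_interp :: "nat \<times> (real list \<Rightarrow> real)" where
  "plus_interp = (2, \<lambda>xs. xs ! 0 + xs ! 1)"

definition one_interp :: "nat \<times> (real list \<Rightarrow> real)" where
  "one_interp = (0, \<lambda>xs. 1)"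

definition less_interp :: "nat \<times> real list set" where
  "less_interp = (2, {[x, y] |x y. x < y})"

definition int_rel :: "real list set" where
  "int_rel = {[x] |x. x \<in> \<int>}"

definition real_plus_less_int :: "(fsym, rsym, real) fo_structure" where
  "real_plus_less_int =
     \<lparr>fns = [Plus \<mapsto> plus_interp], rels = [Less \<mapsto> less_interp, IntPred \<mapsto> (1, int_rel)]\<rparr>"

definition real_plus_less_one :: "(fsym, rsym, real) fo_structure" where
  "real_plus_less_one =
     \<lparr>fns = [Plus \<mapsto> plus_interp, One \<mapsto> one_interp], rels = [Less \<mapsto> less_interp]\<rparr>"

definition real_plus_less_one_set ::
    "nat \<Rightarrow> real list set \<Rightarrow> (fsym, rsym, real) fo_structure" where
  "real_plus_less_one_set n X =
     real_plus_less_one\<lparr>rels := (rels real_plus_less_one)(SetPred \<mapsto> (n, X))\<rparr>"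

end

theory Submission
  imports "HOL-Decision_Procs.MIR" "HOL-Analysis.Continuum_Not_Denumerable" Defs
begin

text \<open>
  Let \<open>M = \<langle>\<real>, +, <, 1, X\<rangle>\<close> and suppose that the integers are not \<open>M\<close>-definable. Quantifier
  elimination for the reals with addition, order and floor shows that an \<open>M\<close>-definable predicate
  changes its value along the \<open>x\<close>-axis only at points where some integer linear form takes an
  integer value, and that it is eventually periodic in \<open>x\<close> with a period independent of the other
  variables. An unbounded \<open>M\<close>-definable set of rationals would have a discrete nonzero group of
  eventual periods, which defines the integers; so \<open>M\<close>-definable sets of rationals are finite.

  By induction on the number of variables every \<open>M\<close>-definable predicate is then semilinear, that
  is, \<open>\<langle>\<real>, +, <, 1\<rangle>\<close>-definable. It suffices that its changes in direction \<open>x\<close> lie on finitely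
  many rational hyperplanes. Changes that persist along a hyperplane over an open set of the other
  variables give an \<open>M\<close>-definable set of rational offsets, which is finite. All other changes
  project to a set which is semilinear by induction and contains no point with coordinates
  independent over the rationals; it lies in finitely many rational hyperplanes, and on each of
  them a further variable can be eliminated.
\<close>

hide_const (open) MIR.A MIR.C MIR.E MIR.F MIR.T
hide_type (open) MIR.fm MIR.num

section \<open>Definable predicates on assignments\<close>

text \<open>The undefinability of the integers enters only through the finiteness of definable sets
  of rationals; the rest is geometry of rational hyperplanes. The obstacle is that floor terms
  permit a change wherever an integer form takes any integer value at all, so the change set is a
  priori spread over infinitely many parallel hyperplanes \<open>x = r + q\<close> with
  \<open>q\<close> rational. Two opposite kinds of points, both dense, cut these down. At points
  with rational coordinates all root functions \<open>r\<close> take rational values, which forces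
  the offset of a persistent family of changes to be rational. At generic points a semilinear
  predicate is locally constant, so by induction a change over a generic point persists nearby. The
  argument treats all \<open>M\<close>-definable predicates and not only \<open>X\<close>, because
  the induction passes through projections of change sets and through substitutions.\<close>

definition dpred :: "('f, 'r, 'a) fo_structure \<Rightarrow> ((nat \<Rightarrow> 'a) \<Rightarrow> bool) \<Rightarrow> bool" where
  "dpred M P \<longleftrightarrow> (\<exists>\<phi>. wf_fm M \<phi> \<and> (\<forall>s. sat M s \<phi> \<longleftrightarrow> P s))"

text \<open>Semantic substitute for a bound on the free variables: the induction counts dependence
  on an assignment, not occurrence in a formula. The result type is arbitrary so that affine forms
  are covered as well.\<close>

definition supported :: "nat set \<Rightarrow> ((nat \<Rightarrow> 'a) \<Rightarrow> 'b) \<Rightarrow> bool" where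
  "supported V P \<longleftrightarrow> (\<forall>s t. (\<forall>i\<in>V. s i = t i) \<longrightarrow> P s = P t)"

lemma supportedD: "supported V P \<Longrightarrow> (\<And>i. i \<in> V \<Longrightarrow> s i = t i) \<Longrightarrow> P s = P t"
  unfolding supported_def by blast

lemma supported_upd: "supported V P \<Longrightarrow> x \<notin> V \<Longrightarrow> P (s(x := a)) = P s"
  by (rule supportedD) auto

lemma dpred_sat: "wf_fm M \<phi> \<Longrightarrow> dpred M (\<lambda>s. sat M s \<phi>)"
  unfolding dpred_def by blast

lemma dpred_neg:
  assumes "dpred M P"
  shows "dpred M (\<lambda>s. \<not> P s)"
proof -
  obtain \<phi> where "wf_fm M \<phi>" "\<And>s. sat M s \<phi> = P s" using assms unfolding dpred_def by blast
  then show ?thesis unfolding dpred_def by (intro exI[of _ "Neg \<phi>"]) simp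
qed

lemma dpred_conj:
  assumes "dpred M P" "dpred M Q"
  shows "dpred M (\<lambda>s. P s \<and> Q s)"
proof -
  obtain \<phi> where "wf_fm M \<phi>" "\<And>s. sat M s \<phi> = P s" using assms unfolding dpred_def by blast
  moreover obtain \<psi> where "wf_fm M \<psi>" "\<And>s. sat M s \<psi> = Q s"
    using assms unfolding dpred_def by blast
  ultimately show ?thesis unfolding dpred_def by (intro exI[of _ "Conj \<phi> \<psi>"]) simp
qed

lemma dpred_disj:
  assumes "dpred M P" "dpred M Q"
  shows "dpred M (\<lambda>s. P s \<or> Q s)"
proof -
  have "dpred M (\<lambda>s. \<not> (\<not> P s \<and> \<not> Q s))" by (intro dpred_neg dpred_conj assms)
  then show ?thesis by simp
qed

lemma dpred_imp:
  assumes "dpred M P" "dpred M Q"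
  shows "dpred M (\<lambda>s. P s \<longrightarrow> Q s)"
proof -
  have "dpred M (\<lambda>s. \<not> P s \<or> Q s)" by (intro dpred_neg dpred_disj assms)
  then show ?thesis by (simp only: imp_conv_disj)
qed

lemma dpred_iff:
  assumes "dpred M P" "dpred M Q"
  shows "dpred M (\<lambda>s. P s \<longleftrightarrow> Q s)"
proof -
  have "dpred M (\<lambda>s. (P s \<longrightarrow> Q s) \<and> (Q s \<longrightarrow> P s))" by (intro dpred_imp dpred_conj assms)
  then show ?thesis by (simp only: iff_conv_conj_imp)
qed

lemma dpred_ex:
  assumes "dpred M P"
  shows "dpred M (\<lambda>s. \<exists>a. P (s(x := a)))"
proof -
  obtain \<phi> where "wf_fm M \<phi>" "\<And>s. sat M s \<phi> = P s" using assms unfolding dpred_def by blast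
  then show ?thesis unfolding dpred_def by (intro exI[of _ "Ex x \<phi>"]) simp
qed

lemma dpred_all:
  assumes "dpred M P"
  shows "dpred M (\<lambda>s. \<forall>a. P (s(x := a)))"
proof -
  have "dpred M (\<lambda>s. \<not> (\<exists>a. \<not> P (s(x := a))))"
    by (intro dpred_neg dpred_ex[of M "\<lambda>s. \<not> P s"] assms)
  then show ?thesis by simp
qed

lemma dpred_const: "dpred M (\<lambda>s. b)"
proof -
  have "dpred M (\<lambda>s. sat M s (Eq (Var 0) (Var 0)))" by (rule dpred_sat) simp
  then have "dpred M (\<lambda>s. True)" by simp
  with dpred_neg[OF this] show ?thesis by (cases b) auto
qed

lemma dpred_ball:
  "finite I \<Longrightarrow> (\<And>i. i \<in> I \<Longrightarrow> dpred M (P i)) \<Longrightarrow> dpred M (\<lambda>s. \<forall>i\<in>I. P i s)"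
  by (induction I rule: finite_induct) (auto intro: dpred_conj dpred_const)

text \<open>The quantified block ranges over assignments that agree with \<open>s\<close> off
  \<open>W\<close>, so no enumeration of \<open>W\<close> appears; the induction adds one variable
  at a time.\<close>

lemma dpred_ex_many:
  assumes "finite W" "dpred M P"
  shows "dpred M (\<lambda>s. \<exists>t. (\<forall>i. i \<notin> W \<longrightarrow> t i = s i) \<and> P t)"
  using assms(1)
proof (induction W rule: finite_induct)
  case empty
  have "(\<exists>t. (\<forall>i. i \<notin> {} \<longrightarrow> t i = s i) \<and> P t) = P s" for s
    by (metis empty_iff ext)
  then show ?case using assms(2) by simp
next
  case (insert x W)
  have "(\<exists>a t. (\<forall>i. i \<notin> W \<longrightarrow> t i = (s(x := a)) i) \<and> P t) =
        (\<exists>t. (\<forall>i. i \<notin> insert x W \<longrightarrow> t i = s i) \<and> P t)" (is "?l = ?r") for s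
  proof
    assume ?r
    then obtain t where t: "\<And>i. i \<notin> insert x W \<Longrightarrow> t i = s i" "P t" by blast
    then have "\<forall>i. i \<notin> W \<longrightarrow> t i = (s(x := t x)) i" by simp
    with t(2) show ?l by blast
  next
    assume ?l
    then obtain a t where "\<forall>i. i \<notin> W \<longrightarrow> t i = (s(x := a)) i" "P t" by blast
    then have "(\<forall>i. i \<notin> insert x W \<longrightarrow> t i = s i) \<and> P t" by auto
    then show ?r by blast
  qed
  with dpred_ex[OF insert.IH, of x] show ?case by simp
qed

lemma finite_vars_trm: "finite (vars_trm t)"
  by (induction t) auto

lemma finite_free_vars: "finite (free_vars \<phi>)"
  by (induction \<phi>) (auto simp: finite_vars_trm)

lemma val_cong: "(\<And>i. i \<in> vars_trm t \<Longrightarrow> s i = s' i) \<Longrightarrow> val M s t = val M s' t"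
proof (induction t)
  case (Fn f ts)
  then have "map (val M s) ts = map (val M s') ts" by fastforce
  then show ?case by (simp del: map_eq_conv)
qed simp

lemma map_val_cong:
  "(\<And>i. i \<in> (\<Union>t\<in>set ts. vars_trm t) \<Longrightarrow> s i = s' i) \<Longrightarrow> map (val M s) ts = map (val M s') ts"
  by (auto intro!: val_cong)

lemma sat_cong: "(\<And>i. i \<in> free_vars \<phi> \<Longrightarrow> s i = s' i) \<Longrightarrow> sat M s \<phi> = sat M s' \<phi>"
proof (induction \<phi> arbitrary: s s')
  case (Eq t u)
  then show ?case using val_cong[of t s s' M] val_cong[of u s s' M] by simp
next
  case (Rel r ts)
  then show ?case using map_val_cong[of ts s s' M] by (simp del: map_eq_conv)
next
  case (Neg \<phi>)
  have "sat M s \<phi> = sat M s' \<phi>" by (rule Neg.IH) (simp add: Neg.prems)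
  then show ?case by simp
next
  case (Conj \<phi> \<psi>)
  have "sat M s \<phi> = sat M s' \<phi>" "sat M s \<psi> = sat M s' \<psi>"
    by (rule Conj.IH; simp add: Conj.prems)+
  then show ?case by simp
next
  case (Ex x \<phi>)
  then have "sat M (s(x := a)) \<phi> = sat M (s'(x := a)) \<phi>" for a by (intro Ex.IH) auto
  then show ?case by simp
qed

lemma dpred_supported:
  assumes "dpred M P"
  obtains V where "finite V" "supported V P"
proof -
  obtain \<phi> where \<phi>: "wf_fm M \<phi>" "\<And>s. sat M s \<phi> = P s" using assms unfolding dpred_def by blast
  have "supported (free_vars \<phi>) P"
    unfolding supported_def using sat_cong[of \<phi> _ _ M] \<phi>(2) by blast
  with that finite_free_vars show ?thesis by blast
qed

section \<open>Renaming of variables and substitution of terms\<close>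

fun rename_trm :: "(nat \<Rightarrow> nat) \<Rightarrow> 'f trm \<Rightarrow> 'f trm" where
  "rename_trm f (Var x) = Var (f x)"
| "rename_trm f (Fn g ts) = Fn g (map (rename_trm f) ts)"

text \<open>Binders are renamed like free occurrences. Capture is excluded by injectivity of the
  renaming, which \<open>sat_rename\<close> requires.\<close>

fun rename_fm :: "(nat \<Rightarrow> nat) \<Rightarrow> ('f, 'r) fm \<Rightarrow> ('f, 'r) fm" where
  "rename_fm f (Eq t u) = Eq (rename_trm f t) (rename_trm f u)"
| "rename_fm f (Rel r ts) = Rel r (map (rename_trm f) ts)"
| "rename_fm f (Neg \<phi>) = Neg (rename_fm f \<phi>)"
| "rename_fm f (Conj \<phi> \<psi>) = Conj (rename_fm f \<phi>) (rename_fm f \<psi>)"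
| "rename_fm f (Ex x \<phi>) = Ex (f x) (rename_fm f \<phi>)"

lemma val_rename: "val M s (rename_trm f t) = val M (\<lambda>i. s (f i)) t"
proof (induction t)
  case (Fn g ts)
  then have "map (val M s \<circ> rename_trm f) ts = map (val M (\<lambda>i. s (f i))) ts" by simp
  then show ?case by (simp del: map_eq_conv)
qed simp

lemma wf_rename_trm: "wf_trm M (rename_trm f t) = wf_trm M t"
  by (induction t) auto

lemma sat_rename:
  assumes "inj f"
  shows "sat M s (rename_fm f \<phi>) = sat M (\<lambda>i. s (f i)) \<phi>"
proof (induction \<phi> arbitrary: s)
  case (Rel r ts)
  have "map (val M s \<circ> rename_trm f) ts = map (val M (\<lambda>i. s (f i))) ts"
    by (simp add: val_rename)
  then show ?case by (simp del: map_eq_conv)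
next
  case (Ex x \<phi>)
  have "(\<lambda>i. (s(f x := a)) (f i)) = (\<lambda>i. s (f i))(x := a)" for a
    using assms by (auto simp: fun_eq_iff inj_eq)
  then show ?case by (simp add: Ex.IH)
qed (simp_all add: val_rename)

lemma wf_rename: "wf_fm M (rename_fm f \<phi>) = wf_fm M \<phi>"
  by (induction \<phi>) (auto simp: wf_rename_trm)

lemma dpred_rename:
  assumes "inj f" "dpred M P"
  shows "dpred M (\<lambda>s. P (\<lambda>i. s (f i)))"
proof -
  obtain \<phi> where \<phi>: "wf_fm M \<phi>" "\<And>s. sat M s \<phi> = P s" using assms unfolding dpred_def by blast
  have "dpred M (\<lambda>s. sat M s (rename_fm f \<phi>))" by (rule dpred_sat) (simp add: wf_rename \<phi>)
  then show ?thesis by (simp add: sat_rename[OF assms(1)] \<phi>(2))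
qed

text \<open>Substitution is replaced by quantification: the equation \<open>x = t\<close> has
  exactly one solution because \<open>x\<close> does not occur in \<open>t\<close>, and no capture
  has to be treated.\<close>

lemma dpred_subst:
  assumes P: "dpred M P" and t: "wf_trm M t" "x \<notin> vars_trm t"
  shows "dpred M (\<lambda>s. P (s(x := val M s t)))"
proof -
  have "dpred M (\<lambda>s. sat M s (Eq (Var x) t))" using t by (intro dpred_sat) simp
  then have "dpred M (\<lambda>s. \<exists>a. sat M (s(x := a)) (Eq (Var x) t) \<and> P (s(x := a)))"
    by (intro dpred_ex[of M "\<lambda>s. sat M s (Eq (Var x) t) \<and> P s"] dpred_conj P)
  moreover have "val M (s(x := a)) t = val M s t" for s a
    using t(2) by (intro val_cong) auto
  ultimately show ?thesis by simp
qed

text \<open>A variable without influence on the truth value can be bound by an existential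
  quantifier, which changes the syntax but not the meaning.\<close>

lemma ex_formula_free_vars:
  assumes "finite W" "wf_fm M \<phi>" "\<And>s x a. x \<in> W \<Longrightarrow> sat M (s(x := a)) \<phi> = sat M s \<phi>"
  shows "\<exists>\<psi>. wf_fm M \<psi> \<and> free_vars \<psi> \<subseteq> free_vars \<phi> - W \<and> (\<forall>s. sat M s \<psi> = sat M s \<phi>)"
  using assms
proof (induction W rule: finite_induct)
  case (insert x W)
  obtain \<psi> where \<psi>: "wf_fm M \<psi>" "free_vars \<psi> \<subseteq> free_vars \<phi> - W" "\<And>s. sat M s \<psi> = sat M s \<phi>"
    using insert by (metis insertCI)
  have "sat M s (Ex x \<psi>) = sat M s \<phi>" for s
  proof -
    have "sat M (s(x := a)) \<psi> = sat M s \<phi>" for a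
      unfolding \<psi>(3) by (rule insert.prems(2)) simp
    then show ?thesis unfolding sat.simps(5) by blast
  qed
  moreover have "wf_fm M (Ex x \<psi>)" "free_vars (Ex x \<psi>) \<subseteq> free_vars \<phi> - insert x W"
    using \<psi> by auto
  ultimately show ?case by blast
qed auto

text \<open>The passage between predicates on assignments and the official notion. A formula may
  mention variables from \<open>k\<close> on; they do not affect membership and get bound.\<close>

lemma definable_iff_dpred:
  "definable M k Y \<longleftrightarrow> Y \<subseteq> tuples k \<and> dpred M (\<lambda>s. map s [0..<k] \<in> Y)"
proof
  assume "definable M k Y"
  then show "Y \<subseteq> tuples k \<and> dpred M (\<lambda>s. map s [0..<k] \<in> Y)"
    unfolding definable_def dpred_def by blast
next
  assume r: "Y \<subseteq> tuples k \<and> dpred M (\<lambda>s. map s [0..<k] \<in> Y)"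
  then obtain \<phi> where \<phi>: "wf_fm M \<phi>" "\<And>s. sat M s \<phi> = (map s [0..<k] \<in> Y)"
    unfolding dpred_def by blast
  define W where "W = free_vars \<phi> - {..<k}"
  have "map (s(x := a)) [0..<k] = map s [0..<k]" if "x \<in> W" for s :: "nat \<Rightarrow> 'c" and x a
    using that by (auto simp: W_def)
  then have "sat M (s(x := a)) \<phi> = sat M s \<phi>" if "x \<in> W" for s x a
    using that by (simp add: \<phi>(2) del: map_eq_conv)
  then obtain \<psi> where "wf_fm M \<psi>" "free_vars \<psi> \<subseteq> free_vars \<phi> - W" "\<forall>s. sat M s \<psi> = sat M s \<phi>"
    using ex_formula_free_vars[of W M \<phi>] \<phi>(1) finite_free_vars[of \<phi>] unfolding W_def by blast
  with r \<phi>(2) show "definable M k Y"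
    unfolding definable_def W_def by (intro conjI exI[of _ \<psi>]) auto
qed

lemma supported_map_upt: "supported {..<k} (\<lambda>s. map s [0..<k] \<in> Y)"
proof -
  have "map s [0..<k] = map t [0..<k]" if "\<forall>i\<in>{..<k}. s i = t i" for s t :: "nat \<Rightarrow> 'a"
    using that by auto
  then show ?thesis unfolding supported_def by metis
qed

section \<open>Rational affine forms\<close>

text \<open>Rational rather than integer coefficients make these forms closed under solving an
  equation for one of its variables.\<close>

definition lin :: "nat set \<Rightarrow> ((nat \<Rightarrow> real) \<Rightarrow> real) set" where
  "lin V = {g. \<exists>c d. (\<forall>i. c i \<in> \<rat>) \<and> d \<in> \<rat> \<and> g = (\<lambda>s. d + (\<Sum>i\<in>V. c i * s i))}"

lemma linI: "(\<And>i. c i \<in> \<rat>) \<Longrightarrow> d \<in> \<rat> \<Longrightarrow> (\<lambda>s. d + (\<Sum>i\<in>V. c i * s i)) \<in> lin V"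
  unfolding lin_def by blast

lemma linE:
  assumes "g \<in> lin V"
  obtains c d where "\<And>i. c i \<in> \<rat>" "d \<in> \<rat>" "\<And>s. g s = d + (\<Sum>i\<in>V. c i * s i)"
  using assms unfolding lin_def by auto

lemma lin_const: "d \<in> \<rat> \<Longrightarrow> (\<lambda>s. d) \<in> lin V"
  using linI[of "\<lambda>_. 0" d V] by simp

lemma lin_var: "finite V \<Longrightarrow> i \<in> V \<Longrightarrow> (\<lambda>s. s i) \<in> lin V"
  using linI[of "\<lambda>j. if j = i then 1 else 0" 0 V]
  by (simp add: if_distrib[of "\<lambda>a. a * _"] sum.delta cong: if_cong)

lemma lin_add:
  assumes "g \<in> lin V" "h \<in> lin V"
  shows "(\<lambda>s. g s + h s) \<in> lin V"
proof -
  obtain c d where 1: "\<And>i. c i \<in> \<rat>" "d \<in> \<rat>" "\<And>s. g s = d + (\<Sum>i\<in>V. c i * s i)"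
    using assms(1) by (rule linE) blast
  obtain c' d' where 2: "\<And>i. c' i \<in> \<rat>" "d' \<in> \<rat>" "\<And>s. h s = d' + (\<Sum>i\<in>V. c' i * s i)"
    using assms(2) by (rule linE) blast
  have "(\<lambda>s. (d + d') + (\<Sum>i\<in>V. (c i + c' i) * s i)) \<in> lin V" using 1 2 by (intro linI) auto
  then show ?thesis by (simp add: 1 2 algebra_simps sum.distrib)
qed

lemma lin_scale:
  assumes "g \<in> lin V" "r \<in> \<rat>"
  shows "(\<lambda>s. r * g s) \<in> lin V"
proof -
  obtain c d where 1: "\<And>i. c i \<in> \<rat>" "d \<in> \<rat>" "\<And>s. g s = d + (\<Sum>i\<in>V. c i * s i)"
    using assms(1) by (rule linE) blast
  have "(\<lambda>s. r * d + (\<Sum>i\<in>V. (r * c i) * s i)) \<in> lin V" using 1 assms by (intro linI) auto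
  then show ?thesis by (simp add: 1 algebra_simps sum_distrib_left)
qed

lemma lin_diff: "g \<in> lin V \<Longrightarrow> h \<in> lin V \<Longrightarrow> (\<lambda>s. g s - h s) \<in> lin V"
  using lin_add[OF _ lin_scale[of h V "-1"], of g] by simp

lemma lin_divide: "g \<in> lin V \<Longrightarrow> r \<in> \<rat> \<Longrightarrow> (\<lambda>s. g s / r) \<in> lin V"
  using lin_scale[of g V "inverse r"] by (simp add: field_simps)

lemma lin_mono:
  assumes "g \<in> lin V" "V \<subseteq> W" "finite W"
  shows "g \<in> lin W"
proof -
  obtain c d where 1: "\<And>i. c i \<in> \<rat>" "d \<in> \<rat>" "\<And>s. g s = d + (\<Sum>i\<in>V. c i * s i)"
    using assms(1) by (rule linE) blast
  have "g = (\<lambda>s. d + (\<Sum>i\<in>W. (if i \<in> V then c i else 0) * s i))"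
  proof
    fix s
    have "(\<Sum>i\<in>W. (if i \<in> V then c i else 0) * s i) = (\<Sum>i\<in>V. c i * s i)"
      using assms(2,3) by (intro sum.mono_neutral_cong_right) auto
    then show "g s = d + (\<Sum>i\<in>W. (if i \<in> V then c i else 0) * s i)" using 1 by simp
  qed
  also have "\<dots> \<in> lin W" using 1 by (intro linI) auto
  finally show ?thesis .
qed

lemma lin_supported: "g \<in> lin V \<Longrightarrow> supported V g"
  unfolding supported_def
proof (intro allI impI)
  fix s t :: "nat \<Rightarrow> real"
  assume g: "g \<in> lin V" and st: "\<forall>i\<in>V. s i = t i"
  obtain c d where "\<And>s. g s = d + (\<Sum>i\<in>V. c i * s i)" using g by (rule linE) blast
  then show "g s = g t" using st by simp
qed

lemma lin_cong: "g \<in> lin V \<Longrightarrow> (\<And>i. i \<in> V \<Longrightarrow> s i = t i) \<Longrightarrow> g s = g t"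
  by (rule supportedD[OF lin_supported])

lemma lin_upd: "g \<in> lin V \<Longrightarrow> x \<notin> V \<Longrightarrow> g (s(x := a)) = g s"
  by (rule supported_upd[OF lin_supported])

lemma lin_Rats: "g \<in> lin V \<Longrightarrow> (\<And>i. i \<in> V \<Longrightarrow> s i \<in> \<rat>) \<Longrightarrow> g s \<in> \<rat>"
  by (erule linE) (auto intro!: Rats_add Rats_sum)

lemma lin_split:
  assumes "g \<in> lin (insert x V)" "finite V" "x \<notin> V"
  obtains c h where "c \<in> \<rat>" "h \<in> lin V" "\<And>s. g s = c * s x + h s"
proof -
  obtain c d where 1: "\<And>i. c i \<in> \<rat>" "d \<in> \<rat>" "\<And>s. g s = d + (\<Sum>i\<in>insert x V. c i * s i)"
    using assms(1) by (rule linE) blast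
  have "(\<lambda>s. d + (\<Sum>i\<in>V. c i * s i)) \<in> lin V" using 1 by (intro linI)
  moreover have "g s = c x * s x + (d + (\<Sum>i\<in>V. c i * s i))" for s
    using 1(3) assms(2,3) by simp
  ultimately show ?thesis using that 1(1) by blast
qed

lemma lin_continuous:
  assumes "g \<in> lin V" "finite V" "\<epsilon> > 0"
  obtains \<delta> where "\<delta> > 0" "\<And>t. (\<And>i. i \<in> V \<Longrightarrow> \<bar>t i - s i\<bar> < \<delta>) \<Longrightarrow> \<bar>g t - g s\<bar> < \<epsilon>"
proof -
  obtain c d where 1: "\<And>s. g s = d + (\<Sum>i\<in>V. c i * s i)"
    using assms(1) by (rule linE) blast
  \<comment> \<open>\<open>K\<close> is a Lipschitz constant for the maximum norm; the summand 1
    keeps it positive when all coefficients vanish.\<close>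
  define K where "K = (\<Sum>i\<in>V. \<bar>c i\<bar>) + 1"
  have K: "K > 0" unfolding K_def by (intro add_nonneg_pos sum_nonneg) auto
  show ?thesis
  proof (rule that[of "\<epsilon> / K"])
    show "\<epsilon> / K > 0" using K assms(3) by simp
    fix t assume t: "\<And>i. i \<in> V \<Longrightarrow> \<bar>t i - s i\<bar> < \<epsilon> / K"
    have "g t - g s = (\<Sum>i\<in>V. c i * (t i - s i))"
      by (simp add: 1 sum_subtractf algebra_simps)
    also have "\<bar>\<dots>\<bar> \<le> (\<Sum>i\<in>V. \<bar>c i\<bar> * (\<epsilon> / K))"
    proof (intro order_trans[OF sum_abs] sum_mono)
      fix i assume "i \<in> V"
      then show "\<bar>c i * (t i - s i)\<bar> \<le> \<bar>c i\<bar> * (\<epsilon> / K)"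
        using t[of i] unfolding abs_mult by (intro mult_left_mono) auto
    qed
    also have "\<dots> = (K - 1) * (\<epsilon> / K)" unfolding K_def by (simp only: sum_distrib_right add_diff_cancel_right')
    also have "\<dots> < K * (\<epsilon> / K)" using K assms(3) by (intro mult_strict_right_mono) auto
    also have "\<dots> = \<epsilon>" using K by simp
    finally show "\<bar>g t - g s\<bar> < \<epsilon>" .
  qed
qed

section \<open>Sign conditions on rational affine forms as formulas\<close>

text \<open>Among the relations only \<open>Less\<close> is prescribed, so that both the base
  structure and its expansion by \<open>X\<close> are instances.\<close>

definition affine_structure :: "(fsym, rsym, real) fo_structure \<Rightarrow> bool" where
  "affine_structure M \<longleftrightarrow>
     fns M = [Plus \<mapsto> plus_interp, One \<mapsto> one_interp] \<and> rels M Less = Some less_interp"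

context
  fixes M :: "(fsym, rsym, real) fo_structure"
  assumes M: "affine_structure M"
begin

text \<open>The signature has no subtraction. A form with integer coefficients is therefore kept as
  a difference of two terms, and its sign is read off by comparing them.\<close>

definition term_difference :: "((nat \<Rightarrow> real) \<Rightarrow> real) \<Rightarrow> bool" where
  "term_difference h \<longleftrightarrow>
     (\<exists>t u. wf_trm M t \<and> wf_trm M u \<and> (\<forall>s. h s = val M s t - val M s u))"

lemma wf_Plus: "wf_trm M (Fn Plus [t, u]) \<longleftrightarrow> wf_trm M t \<and> wf_trm M u"
  and val_Plus: "val M s (Fn Plus [t, u]) = val M s t + val M s u"
  and wf_One: "wf_trm M (Fn One [])"
  and val_One: "val M s (Fn One []) = 1"
  using M by (auto simp: affine_structure_def plus_interp_def one_interp_def)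

lemma term_difference_zero: "term_difference (\<lambda>s. 0)"
  unfolding term_difference_def using wf_One by (metis diff_self)

lemma term_difference_one: "term_difference (\<lambda>s. 1)"
  unfolding term_difference_def
  \<comment> \<open>Without a constant for 0, the number 1 is written as (1 + 1) - 1.\<close>
  by (rule exI[of _ "Fn Plus [Fn One [], Fn One []]"], rule exI[of _ "Fn One []"])
     (simp only: wf_Plus wf_One val_Plus val_One, simp)

lemma term_difference_var: "term_difference (\<lambda>s. s i)"
  unfolding term_difference_def
  by (rule exI[of _ "Fn Plus [Var i, Fn One []]"], rule exI[of _ "Fn One []"])
     (simp only: wf_Plus wf_One val_Plus val_One, simp)

lemma term_difference_neg: "term_difference g \<Longrightarrow> term_difference (\<lambda>s. - g s)"
  unfolding term_difference_def by (metis minus_diff_eq)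

lemma term_difference_add:
  assumes "term_difference g" "term_difference h"
  shows "term_difference (\<lambda>s. g s + h s)"
proof -
  obtain t u where 1: "wf_trm M t" "wf_trm M u" "\<And>s. g s = val M s t - val M s u"
    using assms unfolding term_difference_def by blast
  obtain t' u' where 2: "wf_trm M t'" "wf_trm M u'" "\<And>s. h s = val M s t' - val M s u'"
    using assms unfolding term_difference_def by blast
  show ?thesis unfolding term_difference_def
    by (rule exI[of _ "Fn Plus [t, t']"], rule exI[of _ "Fn Plus [u, u']"])
       (simp only: wf_Plus val_Plus 1 2, simp)
qed

lemma term_difference_of_nat: "term_difference g \<Longrightarrow> term_difference (\<lambda>s. of_nat n * g s)"
  by (induction n) (auto simp: algebra_simps term_difference_zero intro: term_difference_add)

lemma term_difference_of_int: "term_difference g \<Longrightarrow> term_difference (\<lambda>s. of_int n * g s)"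
proof (cases n rule: int_cases2)
  case (nonneg k)
  then show "term_difference g \<Longrightarrow> ?thesis" using term_difference_of_nat[of g k] by simp
next
  case (nonpos k)
  then show "term_difference g \<Longrightarrow> ?thesis"
    using term_difference_neg[OF term_difference_of_nat[of g k]] by simp
qed

text \<open>A positive common denominator turns rational coefficients into integers without
  affecting signs.\<close>

definition scaled_term :: "((nat \<Rightarrow> real) \<Rightarrow> real) \<Rightarrow> bool" where
  "scaled_term g \<longleftrightarrow> (\<exists>N::int. N > 0 \<and> term_difference (\<lambda>s. of_int N * g s))"

lemma scaled_termI: "term_difference g \<Longrightarrow> scaled_term g"
  unfolding scaled_term_def by (rule exI[of _ 1]) simp

lemma scaled_term_add:
  assumes "scaled_term g" "scaled_term h"
  shows "scaled_term (\<lambda>s. g s + h s)"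
proof -
  obtain m n :: int where "m > 0" "term_difference (\<lambda>s. of_int m * g s)"
    and "n > 0" "term_difference (\<lambda>s. of_int n * h s)"
    using assms unfolding scaled_term_def by blast
  then have "m * n > 0"
    "term_difference (\<lambda>s. of_int n * (of_int m * g s) + of_int m * (of_int n * h s))"
    by (auto intro!: term_difference_add term_difference_of_int)
  moreover have "of_int n * (of_int m * g s) + of_int m * (of_int n * h s) =
      of_int (m * n) * (g s + h s)" for s
    by (simp add: algebra_simps)
  ultimately show ?thesis unfolding scaled_term_def by auto
qed

lemma scaled_term_scale:
  assumes "scaled_term g" "r \<in> \<rat>"
  shows "scaled_term (\<lambda>s. r * g s)"
proof -
  obtain m :: int where m: "m > 0" "term_difference (\<lambda>s. of_int m * g s)"
    using assms unfolding scaled_term_def by blast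
  obtain a b :: int where ab: "b > 0" "r = of_int a / of_int b"
    using assms(2) by (auto elim: Rats_cases')
  have "term_difference (\<lambda>s. of_int a * (of_int m * g s))"
    using m(2) by (rule term_difference_of_int)
  moreover have "of_int a * (of_int m * g s) = of_int (m * b) * (r * g s)" for s
    using ab by simp
  ultimately have "term_difference (\<lambda>s. of_int (m * b) * (r * g s))" by (simp only:)
  moreover have "m * b > 0" using m ab by simp
  ultimately show ?thesis unfolding scaled_term_def by blast
qed

lemma scaled_term_lin:
  assumes "g \<in> lin V" "finite V"
  shows "scaled_term g"
proof -
  obtain c d where 1: "\<And>i. c i \<in> \<rat>" "d \<in> \<rat>" "\<And>s. g s = d + (\<Sum>i\<in>V. c i * s i)"
    using assms(1) by (rule linE) blast
  have "scaled_term (\<lambda>s. \<Sum>i\<in>V. c i * s i)"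
    using assms(2)
  proof (induction V rule: finite_induct)
    case empty
    show ?case using scaled_termI[OF term_difference_zero] by simp
  next
    case (insert x V)
    have "scaled_term (\<lambda>s. c x * s x)"
      by (intro scaled_term_scale scaled_termI term_difference_var 1(1))
    from scaled_term_add[OF this insert.IH] show ?case using insert.hyps by simp
  qed
  moreover have "scaled_term (\<lambda>s. d)"
    using scaled_term_scale[OF scaled_termI[OF term_difference_one] 1(2)] by simp
  ultimately have "scaled_term (\<lambda>s. d + (\<Sum>i\<in>V. c i * s i))" by (intro scaled_term_add)
  then show ?thesis by (simp flip: 1(3))
qed

lemma dpred_pos:
  assumes "g \<in> lin V" "finite V"
  shows "dpred M (\<lambda>s. 0 < g s)"
proof -
  obtain N t u where N: "(N::int) > 0" "wf_trm M t" "wf_trm M u"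
    "\<And>s. of_int N * g s = val M s t - val M s u"
    using scaled_term_lin[OF assms] unfolding scaled_term_def term_difference_def by blast
  have "dpred M (\<lambda>s. sat M s (Rel Less [u, t]))"
    using M N by (intro dpred_sat) (simp add: affine_structure_def less_interp_def)
  moreover have "sat M s (Rel Less [u, t]) \<longleftrightarrow> 0 < g s" for s
  proof -
    have "sat M s (Rel Less [u, t]) \<longleftrightarrow> 0 < of_int N * g s"
      using M by (simp add: affine_structure_def less_interp_def N(4))
    also have "\<dots> \<longleftrightarrow> 0 < g s" using N(1) by (simp add: zero_less_mult_iff)
    finally show ?thesis .
  qed
  ultimately show ?thesis by simp
qed

lemma dpred_less:
  assumes "g \<in> lin V" "h \<in> lin V" "finite V"
  shows "dpred M (\<lambda>s. g s < h s)"
  using dpred_pos[OF lin_diff[OF assms(2,1)] assms(3)] by simp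

lemma dpred_eq:
  assumes "g \<in> lin V" "h \<in> lin V" "finite V"
  shows "dpred M (\<lambda>s. g s = h s)"
proof -
  have "dpred M (\<lambda>s. \<not> g s < h s \<and> \<not> h s < g s)"
    by (intro dpred_conj dpred_neg dpred_less[of _ V] assms)
  then show ?thesis by (simp add: not_less eq_iff conj_commute)
qed

lemma dpred_lin_subst:
  assumes "dpred M P" "e \<in> lin V" "finite V" "x \<notin> V"
  shows "dpred M (\<lambda>s. P (s(x := e s)))"
proof -
  have "dpred M (\<lambda>s. s x = e s \<and> P s)"
    using assms by (intro dpred_conj dpred_eq[of _ "insert x V"]) (auto intro: lin_var lin_mono)
  from dpred_ex[OF this, of x] show ?thesis using lin_upd[OF assms(2,4)] by simp
qed

end

section \<open>Semilinear predicates\<close>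

text \<open>
  A Boolean combination of sign conditions on finitely many forms is a predicate that depends on
  their signs only; in this shape closure under Boolean operations is immediate.
\<close>

definition sl :: "nat set \<Rightarrow> ((nat \<Rightarrow> real) \<Rightarrow> bool) \<Rightarrow> bool" where
  "sl V P \<longleftrightarrow> (\<exists>G\<subseteq>lin V. finite G \<and>
     (\<forall>s t. (\<forall>g\<in>G. sgn (g s) = sgn (g t)) \<longrightarrow> P s = P t))"

lemma sl_dpred:
  assumes "affine_structure M" "finite V" "sl V P"
  shows "dpred M P"
proof -
  obtain G where G: "G \<subseteq> lin V" "finite G"
    "\<forall>s t. (\<forall>g\<in>G. sgn (g s) = sgn (g t)) \<longrightarrow> P s = P t"
    using assms(3) unfolding sl_def by blast
  from G(2,1,3) show ?thesis
  proof (induction G arbitrary: P rule: finite_induct)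
    case empty
    then have "P = (\<lambda>s. P undefined)" by auto
    then show ?case by (metis dpred_const)
  next
    case (insert g G)
    \<comment> \<open>\<open>Q c\<close> forgets the sign of \<open>g\<close>: it asks for some
      point of \<open>P\<close> with sign \<open>c\<close> at \<open>g\<close> and with the signs of
      \<open>s\<close> on the other forms. It depends on \<open>G\<close> only, and
      \<open>P s\<close> is \<open>Q\<close> at the actual sign of \<open>g s\<close>.\<close>
    define Q where "Q c s \<longleftrightarrow> (\<exists>t. P t \<and> sgn (g t) = c \<and> (\<forall>h\<in>G. sgn (h s) = sgn (h t)))" for c s
    have Q: "dpred M (Q c)" for c
    proof (rule insert.IH)
      show "G \<subseteq> lin V" using insert.prems by simp
      show "\<forall>s t. (\<forall>g\<in>G. sgn (g s) = sgn (g t)) \<longrightarrow> Q c s = Q c t"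
        unfolding Q_def by metis
    qed
    have g: "g \<in> lin V" using insert.prems by simp
    have "P s \<longleftrightarrow> Q (sgn (g s)) s" for s
      unfolding Q_def using insert.prems(2) by (metis insert_iff)
    then have "P s \<longleftrightarrow> (0 < g s \<and> Q 1 s) \<or> (g s < 0 \<and> Q (-1) s) \<or> (g s = 0 \<and> Q 0 s)" for s
      by (cases "g s" "0::real" rule: linorder_cases) auto
    moreover have "dpred M (\<lambda>s. (0 < g s \<and> Q 1 s) \<or> (g s < 0 \<and> Q (-1) s) \<or> (g s = 0 \<and> Q 0 s))"
      using g assms(1,2)
      by (intro dpred_disj dpred_conj Q dpred_pos[of M g V] dpred_less[of M g V] dpred_eq[of M g V] lin_const)
         auto
    ultimately show ?case by presburger
  qed
qed

lemma sl_const: "sl V (\<lambda>s. b)"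
  unfolding sl_def by (rule exI[of _ "{}"]) auto

section \<open>Quantifier elimination over the reals with the floor function\<close>

lemma dpred_rel: "rels M r = Some (m, R) \<Longrightarrow> dpred M (\<lambda>s. map s [0..<m] \<in> R)"
proof -
  assume r: "rels M r = Some (m, R)"
  have "dpred M (\<lambda>s. sat M s (Rel r (map Var [0..<m])))" by (rule dpred_sat) (simp add: r)
  moreover have "map (val M s \<circ> Var) [0..<m] = map s [0..<m]" for s by simp
  ultimately show ?thesis by (simp add: r del: map_eq_conv)
qed

text \<open>The arguments are first fresh variables \<open>K\<close>, \<open>K + 1\<close>, ...
  beyond all variables of the terms, and are then replaced by the terms one at a time; freshness
  keeps these substitutions from interfering.\<close>

lemma dpred_map_val:
  assumes "dpred M (\<lambda>s. map s [0..<m] \<in> R)" "length ts = m" "\<And>t. t \<in> set ts \<Longrightarrow> wf_trm M t"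
  shows "dpred M (\<lambda>s. map (val M s) ts \<in> R)"
proof -
  have "finite (\<Union>t\<in>set ts. vars_trm t)" by (simp add: finite_vars_trm)
  then obtain K where K: "\<And>t i. t \<in> set ts \<Longrightarrow> i \<in> vars_trm t \<Longrightarrow> i < K"
    by (metis (no_types, lifting) UN_I finite_nat_set_iff_bounded)
  have val_K: "val M (s(K + j := a)) (ts ! i) = val M s (ts ! i)" if "i < m" for s j a i
  proof (rule val_cong)
    fix l assume "l \<in> vars_trm (ts ! i)"
    then have "l < K" using K[of "ts ! i" l] that assms(2) by auto
    then show "(s(K + j := a)) l = s l" by simp
  qed
  have "j \<le> m \<Longrightarrow>
    dpred M (\<lambda>s. map (\<lambda>i. if i < j then val M s (ts ! i) else s (K + i)) [0..<m] \<in> R)" for j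
  proof (induction j)
    case 0
    have "inj (\<lambda>i. K + i)" by simp
    from dpred_rename[OF this assms(1)] show ?case by simp
  next
    case (Suc j)
    let ?f = "\<lambda>j s i. if i < j then val M s (ts ! i) else s (K + i)"
    have "K + j \<notin> vars_trm (ts ! j)" using K[of "ts ! j" "K + j"] Suc.prems assms(2) by auto
    then have "dpred M (\<lambda>s. map (?f j (s(K + j := val M s (ts ! j)))) [0..<m] \<in> R)"
      using Suc assms(2,3) by (intro dpred_subst[of M "\<lambda>s. map (?f j s) [0..<m] \<in> R"]) auto
    moreover have "map (?f j (s(K + j := val M s (ts ! j)))) [0..<m] = map (?f (Suc j) s) [0..<m]" for s
      using val_K by (intro map_cong) (auto simp: less_Suc_eq)
    ultimately show ?case by (simp only:)
  qed
  from this[of m] have "dpred M (\<lambda>s. map (\<lambda>i. if i < m then val M s (ts ! i) else s (K + i)) [0..<m] \<in> R)"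
    by simp
  moreover have "map (\<lambda>i. if i < m then val M s (ts ! i) else s (K + i)) [0..<m] = map (val M s) ts" for s
    using assms(2) by (intro nth_equalityI) auto
  ultimately show ?thesis by (simp only:)
qed

lemma val_fns: "fns M = fns N \<Longrightarrow> val M s t = val N s t"
proof (induction t)
  case (Fn f ts)
  then have "map (val M s) ts = map (val N s) ts" by simp
  then show ?case using Fn.prems by (simp del: map_eq_conv)
qed simp

lemma wf_trm_fns: "fns M = fns N \<Longrightarrow> wf_trm M t = wf_trm N t"
  by (induction t) auto

text \<open>Each relation symbol of \<open>M\<close> is replaced by its definition in
  \<open>N\<close>; equal function symbols leave terms unchanged.\<close>

lemma dpred_interpret:
  assumes "fns M = fns N"
    and "\<And>r m R. rels M r = Some (m, R) \<Longrightarrow> dpred N (\<lambda>s. map s [0..<m] \<in> R)"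
    and "dpred M P"
  shows "dpred N P"
proof -
  have "dpred N (\<lambda>s. sat M s \<phi>)" if "wf_fm M \<phi>" for \<phi>
    using that
  proof (induction \<phi>)
    case (Eq t u)
    then have "dpred N (\<lambda>s. sat N s (Eq t u))"
      by (intro dpred_sat) (simp add: wf_trm_fns[OF assms(1)])
    then show ?case by (simp add: val_fns[OF assms(1)])
  next
    case (Rel r ts)
    then obtain R where R: "rels M r = Some (length ts, R)" by auto
    then have "dpred N (\<lambda>s. map (val N s) ts \<in> R)"
      using Rel by (intro dpred_map_val[OF assms(2)]) (auto simp: wf_trm_fns[OF assms(1)])
    moreover have "map (val M s) ts = map (val N s) ts" for s by (simp add: val_fns[OF assms(1)])
    ultimately show ?case by (simp add: R del: map_eq_conv)
  qed (auto intro: dpred_neg dpred_conj dpred_ex)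
  with assms(3) show ?thesis unfolding dpred_def by metis
qed

lemma wf_trm_map_le: "fns M \<subseteq>\<^sub>m fns N \<Longrightarrow> wf_trm M t \<Longrightarrow> wf_trm N t \<and> val N s t = val M s t"
proof (induction t)
  case (Fn f ts)
  then obtain F where F: "fns M f = Some (length ts, F)" by auto
  then have F': "fns N f = Some (length ts, F)" using Fn.prems(1) by (metis domI map_le_def)
  have "map (val N s) ts = map (val M s) ts" using Fn by simp
  then show ?case using Fn F F' by (simp del: map_eq_conv)
qed simp

lemma dpred_map_le:
  assumes "fns M \<subseteq>\<^sub>m fns N" "rels M \<subseteq>\<^sub>m rels N" "dpred M P"
  shows "dpred N P"
proof -
  have "wf_fm N \<phi> \<and> (\<forall>s. sat N s \<phi> = sat M s \<phi>)" if "wf_fm M \<phi>" for \<phi>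
    using that
  proof (induction \<phi>)
    case (Rel r ts)
    then obtain R where R: "rels M r = Some (length ts, R)" by auto
    then have R': "rels N r = Some (length ts, R)" using assms(2) by (metis domI map_le_def)
    have "map (val N s) ts = map (val M s) ts" for s using Rel wf_trm_map_le[OF assms(1)] by simp
    then show ?case using Rel wf_trm_map_le[OF assms(1)] R R' by (simp del: map_eq_conv)
  qed (simp_all add: wf_trm_map_le[OF assms(1)])
  with assms(3) show ?thesis unfolding dpred_def by metis
qed

text \<open>The integer structure with the constant 1 added, so that its function symbols agree with
  those of the expansion by \<open>X\<close>, as \<open>dpred_interpret\<close> demands.\<close>

definition real_plus_less_one_int :: "(fsym, rsym, real) fo_structure" where
  "real_plus_less_one_int =
     \<lparr>fns = [Plus \<mapsto> plus_interp, One \<mapsto> one_interp],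
      rels = [Less \<mapsto> less_interp, IntPred \<mapsto> (1, int_rel)]\<rparr>"

lemma dpred_real_plus_less_int:
  "dpred real_plus_less_int P \<Longrightarrow> dpred real_plus_less_one_int P"
  by (rule dpred_map_le)
     (auto simp: real_plus_less_int_def real_plus_less_one_int_def map_le_def)

section \<open>Translation into the mixed real-integer language\<close>

text \<open>\<open>\<iota>\<close> sends variable names to de Bruijn positions. The last clause is
  meant for the constant 1; on ill-formed terms it is a default.\<close>

fun mir_trm :: "(nat \<Rightarrow> nat) \<Rightarrow> fsym trm \<Rightarrow> MIR.num" where
  "mir_trm \<iota> (Var x) = MIR.Bound (\<iota> x)"
| "mir_trm \<iota> (Fn Plus [t, u]) = MIR.Add (mir_trm \<iota> t) (mir_trm \<iota> u)"
| "mir_trm \<iota> (Fn _ _) = MIR.C 1"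

text \<open>Being an integer is divisibility by 1. The clause with \<open>MIR.F\<close> is a default
  for ill-formed atoms and for \<open>SetPred\<close>, which the integer structure does not
  interpret. A quantifier takes position 0 and shifts all others.\<close>

fun mir_fm :: "(nat \<Rightarrow> nat) \<Rightarrow> (fsym, rsym) fm \<Rightarrow> MIR.fm" where
  "mir_fm \<iota> (Eq t u) = MIR.Eq (MIR.Sub (mir_trm \<iota> t) (mir_trm \<iota> u))"
| "mir_fm \<iota> (Rel Less [t, u]) = MIR.Lt (MIR.Sub (mir_trm \<iota> t) (mir_trm \<iota> u))"
| "mir_fm \<iota> (Rel IntPred [t]) = MIR.Dvd 1 (mir_trm \<iota> t)"
| "mir_fm \<iota> (Rel _ _) = MIR.F"
| "mir_fm \<iota> (Neg \<phi>) = MIR.Not (mir_fm \<iota> \<phi>)"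
| "mir_fm \<iota> (Conj \<phi> \<psi>) = MIR.And (mir_fm \<iota> \<phi>) (mir_fm \<iota> \<psi>)"
| "mir_fm \<iota> (Ex x \<phi>) = MIR.E (mir_fm (\<lambda>y. if y = x then 0 else Suc (\<iota> y)) \<phi>)"

lemma Inum_mir_trm:
  assumes "wf_trm real_plus_less_one_int t" "\<And>y. y \<in> vars_trm t \<Longrightarrow> bs ! \<iota> y = s y"
  shows "Inum bs (mir_trm \<iota> t) = val real_plus_less_one_int s t"
  using assms
proof (induction \<iota> t rule: mir_trm.induct)
  case (2 \<iota> t u)
  then show ?case by (simp add: real_plus_less_one_int_def plus_interp_def)
qed (auto simp: real_plus_less_one_int_def plus_interp_def one_interp_def)

lemma Ifm_mir_fm:
  assumes "wf_fm real_plus_less_one_int \<phi>" "\<And>y. y \<in> free_vars \<phi> \<Longrightarrow> bs ! \<iota> y = s y"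
  shows "Ifm bs (mir_fm \<iota> \<phi>) = sat real_plus_less_one_int s \<phi>"
  using assms
proof (induction \<iota> \<phi> arbitrary: bs s rule: mir_fm.induct)
  case (1 \<iota> t u)
  then show ?case by (simp add: Inum_mir_trm[of _ bs \<iota> s])
next
  case (2 \<iota> t u)
  then show ?case
    by (simp add: Inum_mir_trm[of _ bs \<iota> s])
       (simp add: real_plus_less_one_int_def less_interp_def)
next
  case (3 \<iota> t)
  then show ?case
    by (simp add: Inum_mir_trm[of _ bs \<iota> s])
       (auto simp: real_plus_less_one_int_def int_rel_def rdvd_def Ints_def)
next
  case (7 \<iota> x \<phi>)
  then show ?case
  proof -
    have "Ifm (a # bs) (mir_fm (\<lambda>y. if y = x then 0 else Suc (\<iota> y)) \<phi>) =
      sat real_plus_less_one_int (s(x := a)) \<phi>" for a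
      using 7(2,3) by (intro 7(1)) auto
    then show ?thesis by simp
  qed
qed (auto simp: real_plus_less_one_int_def less_interp_def)

primrec num_vars :: "MIR.num \<Rightarrow> nat set" where
  "num_vars (MIR.C c) = {}"
| "num_vars (MIR.Bound n) = {n}"
| "num_vars (MIR.CN n c a) = insert n (num_vars a)"
| "num_vars (MIR.Neg a) = num_vars a"
| "num_vars (MIR.Add a b) = num_vars a \<union> num_vars b"
| "num_vars (MIR.Sub a b) = num_vars a \<union> num_vars b"
| "num_vars (MIR.Mul c a) = num_vars a"
| "num_vars (MIR.Floor a) = num_vars a"
| "num_vars (MIR.CF c a b) = num_vars a \<union> num_vars b"

text \<open>The empty set for quantified formulas is a default; the values matter for
  quantifier-free formulas only.\<close>

primrec qf_vars :: "MIR.fm \<Rightarrow> nat set" where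
  "qf_vars MIR.T = {}"
| "qf_vars MIR.F = {}"
| "qf_vars (MIR.Lt a) = num_vars a"
| "qf_vars (MIR.Le a) = num_vars a"
| "qf_vars (MIR.Gt a) = num_vars a"
| "qf_vars (MIR.Ge a) = num_vars a"
| "qf_vars (MIR.Eq a) = num_vars a"
| "qf_vars (MIR.NEq a) = num_vars a"
| "qf_vars (MIR.Dvd i a) = num_vars a"
| "qf_vars (MIR.NDvd i a) = num_vars a"
| "qf_vars (MIR.Not p) = qf_vars p"
| "qf_vars (MIR.And p q) = qf_vars p \<union> qf_vars q"
| "qf_vars (MIR.Or p q) = qf_vars p \<union> qf_vars q"
| "qf_vars (MIR.Imp p q) = qf_vars p \<union> qf_vars q"
| "qf_vars (MIR.Iff p q) = qf_vars p \<union> qf_vars q"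
| "qf_vars (MIR.E p) = {}"
| "qf_vars (MIR.A p) = {}"

lemma finite_num_vars: "finite (num_vars t)"
  by (induction t) auto

lemma finite_qf_vars: "finite (qf_vars p)"
  by (induction p) (auto simp: finite_num_vars)

text \<open>\<open>k\<close> bounds the variables of the formula both before and after quantifier
  elimination, so that one finite list of values serves both.\<close>

lemma dpred_mir:
  assumes "dpred real_plus_less_one_int P"
  obtains k p where "MIR.qfree p" "qf_vars p \<subseteq> {..<k}" "\<And>s. P s = Ifm (map s [0..<k]) p"
proof -
  obtain \<phi> where \<phi>: "wf_fm real_plus_less_one_int \<phi>" "\<And>s. sat real_plus_less_one_int s \<phi> = P s"
    using assms unfolding dpred_def by blast
  define p where "p = mirlfrqe (mir_fm id \<phi>)"
  have "finite (free_vars \<phi> \<union> qf_vars p)" by (simp add: finite_free_vars finite_qf_vars)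
  then obtain k where k: "\<And>i. i \<in> free_vars \<phi> \<union> qf_vars p \<Longrightarrow> i < k"
    by (metis finite_nat_set_iff_bounded)
  have "P s = Ifm (map s [0..<k]) p" for s
  proof -
    have "P s = Ifm (map s [0..<k]) (mir_fm id \<phi>)"
      using k by (subst Ifm_mir_fm[where s = s]) (auto simp: \<phi>)
    also have "\<dots> = Ifm (map s [0..<k]) p" unfolding p_def using mirlfrqe by blast
    finally show ?thesis .
  qed
  moreover have "MIR.qfree p" unfolding p_def using mirlfrqe by blast
  ultimately show ?thesis using that k by blast
qed

section \<open>Points where a definable predicate can change in one variable\<close>

text \<open>Constants other than 0 are absent: an integer constant is absorbed into the integer
  error of \<open>locally_form\<close>.\<close>

inductive_set int_forms :: "((nat \<Rightarrow> real) \<Rightarrow> real) set" where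
  zero: "(\<lambda>s. 0) \<in> int_forms"
| var: "(\<lambda>s. s i) \<in> int_forms"
| add: "g \<in> int_forms \<Longrightarrow> h \<in> int_forms \<Longrightarrow> (\<lambda>s. g s + h s) \<in> int_forms"
| scale: "g \<in> int_forms \<Longrightarrow> (\<lambda>s. of_int c * g s) \<in> int_forms"

lemma int_forms_upd:
  "g \<in> int_forms \<Longrightarrow> \<exists>a::int. \<forall>s y. g (s(x := y)) = g s + of_int a * (y - s x)"
proof (induction rule: int_forms.induct)
  case zero
  show ?case by (rule exI[of _ 0]) simp
next
  case (var i)
  show ?case by (rule exI[of _ "if i = x then 1 else 0"]) simp
next
  case (add g h)
  then obtain a b :: int where ab: "\<And>s y. g (s(x := y)) = g s + of_int a * (y - s x)"
    "\<And>s y. h (s(x := y)) = h s + of_int b * (y - s x)" by blast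
  have "g (s(x := y)) + h (s(x := y)) = g s + h s + of_int (a + b) * (y - s x)" for s y
    unfolding ab by (simp add: algebra_simps)
  then show ?case by blast
next
  case (scale g c)
  then obtain a :: int where a: "\<And>s y. g (s(x := y)) = g s + of_int a * (y - s x)" by blast
  have "of_int c * g (s(x := y)) = of_int c * g s + of_int (c * a) * (y - s x)" for s y
    unfolding a by (simp add: algebra_simps)
  then show ?case by blast
qed

lemma int_forms_restrict:
  assumes "g \<in> int_forms" "finite V"
  shows "(\<lambda>s. g (\<lambda>i. if i \<in> V then s i else 0)) \<in> lin V"
  using assms(1)
proof (induction rule: int_forms.induct)
  case (var i)
  show ?case by (cases "i \<in> V") (simp_all add: lin_var lin_const assms(2))
qed (auto intro: lin_const lin_add lin_scale)

text \<open>The slope in \<open>x\<close> is nonzero, so that integrality of the value confines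
  \<open>x\<close> to a discrete set on each line in that direction.\<close>

definition moving_forms :: "nat \<Rightarrow> ((nat \<Rightarrow> real) \<Rightarrow> real) set" where
  "moving_forms x = {g \<in> int_forms. \<exists>a::int. a \<noteq> 0 \<and> (\<forall>s y. g (s(x := y)) = g s + of_int a * (y - s x))}"

lemma int_forms_cases:
  assumes "g \<in> int_forms"
  obtains "g \<in> moving_forms x" | "\<And>s y. g (s(x := y)) = g s"
proof -
  obtain a :: int where a: "\<forall>s y. g (s(x := y)) = g s + of_int a * (y - s x)"
    using int_forms_upd[OF assms] by blast
  show ?thesis
  proof (cases "a = 0")
    case True
    with a that(2) show ?thesis by simp
  next
    case False
    with a assms that(1) show ?thesis unfolding moving_forms_def by blast
  qed
qed

lemma moving_forms_floor:
  assumes "g \<in> moving_forms x" "g s \<notin> \<int>"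
  shows "\<forall>\<^sub>F y in nhds (s x). of_int \<lfloor>g s\<rfloor> < g (s(x := y)) \<and> g (s(x := y)) < of_int \<lfloor>g s\<rfloor> + 1"
proof -
  obtain a :: int where a: "\<And>s y. g (s(x := y)) = g s + of_int a * (y - s x)"
    using assms(1) unfolding moving_forms_def by blast
  have "((\<lambda>y. g s + of_int a * (y - s x)) \<longlongrightarrow> g s + of_int a * (s x - s x)) (nhds (s x))"
    by (intro tendsto_intros filterlim_ident)
  then have lim: "((\<lambda>y. g (s(x := y))) \<longlongrightarrow> g s) (nhds (s x))" by (simp add: a)
  have "of_int \<lfloor>g s\<rfloor> \<noteq> g s" using assms(2) by (metis Ints_of_int)
  then have "of_int \<lfloor>g s\<rfloor> < g s" "g s < of_int \<lfloor>g s\<rfloor> + 1" by linarith+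
  then show ?thesis using order_tendstoD[OF lim] by (auto intro: eventually_conj)
qed

text \<open>
  Every term is an integer form up to an integer-valued error, and the error is locally
  constant in \<open>x\<close> wherever the forms inside the floor brackets avoid the integers.
\<close>

definition locally_form :: "nat \<Rightarrow> ((nat \<Rightarrow> real) \<Rightarrow> real) \<Rightarrow> bool" where
  "locally_form x f \<longleftrightarrow> (\<exists>L\<in>int_forms. \<exists>Q\<subseteq>moving_forms x. finite Q \<and>
     (\<forall>s. (\<forall>g\<in>Q. g s \<notin> \<int>) \<longrightarrow>
        (\<exists>j::int. \<forall>\<^sub>F y in nhds (s x). f (s(x := y)) = L (s(x := y)) + of_int j)))"

lemma locally_formI: "L \<in> int_forms \<Longrightarrow> (\<And>s. f s = L s + of_int j) \<Longrightarrow> locally_form x f"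
  unfolding locally_form_def by (intro bexI[of _ L] exI[of _ "{}"]) auto

lemma locally_form_add:
  assumes "locally_form x f" "locally_form x f'"
  shows "locally_form x (\<lambda>s. f s + f' s)"
proof -
  obtain L Q where 1: "L \<in> int_forms" "Q \<subseteq> moving_forms x" "finite Q"
    "\<And>s. \<forall>g\<in>Q. g s \<notin> \<int> \<Longrightarrow> \<exists>j::int. \<forall>\<^sub>F y in nhds (s x). f (s(x := y)) = L (s(x := y)) + of_int j"
    using assms(1) unfolding locally_form_def by metis
  obtain L' Q' where 2: "L' \<in> int_forms" "Q' \<subseteq> moving_forms x" "finite Q'"
    "\<And>s. \<forall>g\<in>Q'. g s \<notin> \<int> \<Longrightarrow> \<exists>j::int. \<forall>\<^sub>F y in nhds (s x). f' (s(x := y)) = L' (s(x := y)) + of_int j"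
    using assms(2) unfolding locally_form_def by metis
  show ?thesis unfolding locally_form_def
  proof (intro bexI[of _ "\<lambda>s. L s + L' s"] exI[of _ "Q \<union> Q'"] conjI allI impI)
    fix s assume s: "\<forall>g\<in>Q \<union> Q'. g s \<notin> \<int>"
    obtain j j' :: int where "\<forall>\<^sub>F y in nhds (s x). f (s(x := y)) = L (s(x := y)) + of_int j"
      "\<forall>\<^sub>F y in nhds (s x). f' (s(x := y)) = L' (s(x := y)) + of_int j'"
      using 1(4)[of s] 2(4)[of s] s by blast
    then have "\<forall>\<^sub>F y in nhds (s x). f (s(x := y)) + f' (s(x := y)) =
        L (s(x := y)) + L' (s(x := y)) + of_int (j + j')"
      by eventually_elim simp
    then show "\<exists>j::int. \<forall>\<^sub>F y in nhds (s x). f (s(x := y)) + f' (s(x := y)) =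
        L (s(x := y)) + L' (s(x := y)) + of_int j" by blast
  qed (use 1 2 in \<open>auto intro: int_forms.add\<close>)
qed

lemma locally_form_scale:
  assumes "locally_form x f"
  shows "locally_form x (\<lambda>s. of_int c * f s)"
proof -
  obtain L Q where 1: "L \<in> int_forms" "Q \<subseteq> moving_forms x" "finite Q"
    "\<And>s. \<forall>g\<in>Q. g s \<notin> \<int> \<Longrightarrow> \<exists>j::int. \<forall>\<^sub>F y in nhds (s x). f (s(x := y)) = L (s(x := y)) + of_int j"
    using assms(1) unfolding locally_form_def by metis
  show ?thesis unfolding locally_form_def
  proof (intro bexI[of _ "\<lambda>s. of_int c * L s"] exI[of _ Q] conjI allI impI)
    fix s assume "\<forall>g\<in>Q. g s \<notin> \<int>"
    then obtain j :: int where "\<forall>\<^sub>F y in nhds (s x). f (s(x := y)) = L (s(x := y)) + of_int j"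
      using 1(4)[of s] by blast
    then have "\<forall>\<^sub>F y in nhds (s x). of_int c * f (s(x := y)) =
        of_int c * L (s(x := y)) + of_int (c * j)"
      by eventually_elim (simp add: algebra_simps)
    then show "\<exists>j::int. \<forall>\<^sub>F y in nhds (s x). of_int c * f (s(x := y)) =
        of_int c * L (s(x := y)) + of_int j" by blast
  qed (use 1 in \<open>auto intro: int_forms.scale\<close>)
qed

text \<open>If \<open>L\<close> moves in \<open>x\<close>, its floor is locally constant off the
  integers, so \<open>L\<close> joins the forms to be avoided; otherwise its floor is constant along
  \<open>x\<close> anyway. Either way the floor of \<open>f\<close> is locally a constant integer,
  an error added to the zero form.\<close>

lemma locally_form_floor:
  assumes "locally_form x f"
  shows "locally_form x (\<lambda>s. of_int \<lfloor>f s\<rfloor>)"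
proof -
  obtain L Q where 1: "L \<in> int_forms" "Q \<subseteq> moving_forms x" "finite Q"
    "\<And>s. \<forall>g\<in>Q. g s \<notin> \<int> \<Longrightarrow> \<exists>j::int. \<forall>\<^sub>F y in nhds (s x). f (s(x := y)) = L (s(x := y)) + of_int j"
    using assms(1) unfolding locally_form_def by metis
  define Q' where "Q' = (if L \<in> moving_forms x then insert L Q else Q)"
  show ?thesis unfolding locally_form_def
  proof (intro bexI[of _ "\<lambda>s. 0"] exI[of _ Q'] conjI allI impI)
    fix s assume s: "\<forall>g\<in>Q'. g s \<notin> \<int>"
    then obtain j :: int where j: "\<forall>\<^sub>F y in nhds (s x). f (s(x := y)) = L (s(x := y)) + of_int j"
      using 1(4)[of s] unfolding Q'_def by (auto split: if_splits)
    have "\<forall>\<^sub>F y in nhds (s x). \<lfloor>L (s(x := y))\<rfloor> = \<lfloor>L s\<rfloor>"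
    proof (cases rule: int_forms_cases[OF 1(1), of x])
      case 1
      then have "\<forall>\<^sub>F y in nhds (s x). of_int \<lfloor>L s\<rfloor> < L (s(x := y)) \<and> L (s(x := y)) < of_int \<lfloor>L s\<rfloor> + 1"
        using s by (intro moving_forms_floor) (simp_all add: Q'_def)
      then show ?thesis by eventually_elim (simp add: floor_eq_iff)
    qed simp
    with j have "\<forall>\<^sub>F y in nhds (s x). of_int \<lfloor>f (s(x := y))\<rfloor> = 0 + of_int (\<lfloor>L s\<rfloor> + j)"
      by eventually_elim simp
    then show "\<exists>j::int. \<forall>\<^sub>F y in nhds (s x). of_int \<lfloor>f (s(x := y))\<rfloor> = 0 + of_int j" by blast
  qed (use 1 in \<open>auto intro: int_forms.zero simp: Q'_def\<close>)
qed

lemma locally_form_Inum: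
  "num_vars t \<subseteq> {..<k} \<Longrightarrow> locally_form x (\<lambda>s. Inum (map s [0..<k]) t)"
proof (induction t)
  case (C c)
  show ?case by (rule locally_formI[OF int_forms.zero, of _ c]) simp
next
  case (Bound n)
  show ?case by (rule locally_formI[OF int_forms.var[of n], of _ 0]) (use Bound in simp)
next
  case (CN n c a)
  have "locally_form x (\<lambda>s. of_int c * s n)"
    by (rule locally_form_scale[OF locally_formI[OF int_forms.var[of n], of _ 0]]) simp
  from locally_form_add[OF this CN.IH] CN.prems show ?case by simp
next
  case (Neg a)
  then show ?case using locally_form_scale[of x _ "-1"] by simp
next
  case (Add a b)
  then show ?case by (simp add: locally_form_add)
next
  case (Sub a b)
  then have "locally_form x (\<lambda>s. Inum (map s [0..<k]) a + of_int (-1) * Inum (map s [0..<k]) b)"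
    by (intro locally_form_add locally_form_scale) auto
  then show ?case by simp
next
  case (Mul c a)
  then show ?case by (simp add: locally_form_scale)
next
  case (Floor a)
  then show ?case by (simp add: locally_form_floor)
next
  case (CF c a b)
  then show ?case by (simp add: locally_form_floor locally_form_scale locally_form_add)
qed

definition critical :: "nat \<Rightarrow> ((nat \<Rightarrow> real) \<Rightarrow> bool) \<Rightarrow> bool" where
  "critical x P \<longleftrightarrow> (\<exists>Q\<subseteq>moving_forms x. finite Q \<and>
     (\<forall>s. (\<forall>g\<in>Q. g s \<notin> \<int>) \<longrightarrow> (\<forall>\<^sub>F y in nhds (s x). P (s(x := y)) = P s)))"

lemma critical_combine:
  assumes "critical x P" "critical x P'"
  shows "critical x (\<lambda>s. f (P s) (P' s))"
proof -
  obtain Q where 1: "Q \<subseteq> moving_forms x" "finite Q"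
    "\<And>s. \<forall>g\<in>Q. g s \<notin> \<int> \<Longrightarrow> \<forall>\<^sub>F y in nhds (s x). P (s(x := y)) = P s"
    using assms(1) unfolding critical_def by metis
  obtain Q' where 2: "Q' \<subseteq> moving_forms x" "finite Q'"
    "\<And>s. \<forall>g\<in>Q'. g s \<notin> \<int> \<Longrightarrow> \<forall>\<^sub>F y in nhds (s x). P' (s(x := y)) = P' s"
    using assms(2) unfolding critical_def by metis
  show ?thesis unfolding critical_def
  proof (intro exI[of _ "Q \<union> Q'"] conjI allI impI)
    fix s assume s: "\<forall>g\<in>Q \<union> Q'. g s \<notin> \<int>"
    then have "\<forall>\<^sub>F y in nhds (s x). P (s(x := y)) = P s" "\<forall>\<^sub>F y in nhds (s x). P' (s(x := y)) = P' s"
      by (intro 1(3) 2(3); simp)+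
    then show "\<forall>\<^sub>F y in nhds (s x). f (P (s(x := y))) (P' (s(x := y))) = f (P s) (P' s)"
      by eventually_elim simp
  qed (use 1 2 in auto)
qed

lemma critical_const: "critical x (\<lambda>s. b)"
  unfolding critical_def by (rule exI[of _ "{}"]) simp

lemma critical_not: "critical x P \<Longrightarrow> critical x (\<lambda>s. \<not> P s)"
  using critical_combine[of x P P "\<lambda>a b. \<not> a"] by simp

text \<open>Near a point that avoids the critical forms, \<open>f\<close> either does not change or
  stays strictly between two consecutive integers. There its sign is fixed and it is not an integer,
  which settles sign conditions and divisibility respectively.\<close>

lemma critical_atom:
  assumes "locally_form x f"
    and R: "(\<forall>u v. sgn u = sgn v \<longrightarrow> R u = R v) \<or> (\<forall>u. u \<notin> \<int> \<longrightarrow> \<not> R u)"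
  shows "critical x (\<lambda>s. R (f s))"
proof -
  obtain L Q where 1: "L \<in> int_forms" "Q \<subseteq> moving_forms x" "finite Q"
    "\<And>s. \<forall>g\<in>Q. g s \<notin> \<int> \<Longrightarrow> \<exists>j::int. \<forall>\<^sub>F y in nhds (s x). f (s(x := y)) = L (s(x := y)) + of_int j"
    using assms(1) unfolding locally_form_def by metis
  define Q' where "Q' = (if L \<in> moving_forms x then insert L Q else Q)"
  show ?thesis unfolding critical_def
  proof (intro exI[of _ Q'] conjI allI impI)
    fix s assume s: "\<forall>g\<in>Q'. g s \<notin> \<int>"
    then obtain j :: int where j: "\<forall>\<^sub>F y in nhds (s x). f (s(x := y)) = L (s(x := y)) + of_int j"
      using 1(4)[of s] unfolding Q'_def by (auto split: if_splits)
    from eventually_nhds_x_imp_x[OF j] have fs: "f s = L s + of_int j" by simp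
    show "\<forall>\<^sub>F y in nhds (s x). R (f (s(x := y))) = R (f s)"
    proof (cases rule: int_forms_cases[OF 1(1), of x])
      case 1
      then have "L s \<notin> \<int>" using s by (simp add: Q'_def)
      then have L: "of_int \<lfloor>L s\<rfloor> < L s" by (metis Ints_of_int of_int_floor_le order_le_less)
      have "\<forall>\<^sub>F y in nhds (s x). of_int \<lfloor>L s\<rfloor> < L (s(x := y)) \<and> L (s(x := y)) < of_int \<lfloor>L s\<rfloor> + 1"
        using 1 s by (intro moving_forms_floor) (simp_all add: Q'_def)
      with j show ?thesis
      proof eventually_elim
        case (elim y)
        define m where "m = \<lfloor>L s\<rfloor> + j"
        have b: "of_int m < f s" "f s < of_int m + 1" "of_int m < f (s(x := y))" "f (s(x := y)) < of_int m + 1"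
          using elim L fs unfolding m_def of_int_add by linarith+
        have notin: "u \<notin> \<int>" if "of_int m < u" "u < of_int m + 1" for u :: real
        proof
          assume "u \<in> \<int>"
          then obtain i where "u = of_int i" by (auto elim: Ints_cases)
          with that have "real_of_int m < real_of_int i" "real_of_int i < real_of_int (m + 1)" by simp_all
          then have "m < i" "i < m + 1" by (simp_all only: of_int_less_iff)
          then show False by simp
        qed
        have "sgn u = sgn v" if "of_int m < u" "u < of_int m + 1" "of_int m < v" "v < of_int m + 1"
          for u v :: real
        proof (cases "m \<ge> 0")
          case True
          then have "(of_int m :: real) \<ge> 0" by simp
          with that show ?thesis by simp
        next
          case False
          then have "m + 1 \<le> 0" by simp
          then have "(of_int (m + 1) :: real) \<le> 0" by (simp only: of_int_le_0_iff)
          with that show ?thesis by simp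
        qed
        with R b notin show ?case by metis
      qed
    next
      case 2
      from j show ?thesis by eventually_elim (simp add: 2 fs)
    qed
  qed (use 1 in \<open>auto simp: Q'_def\<close>)
qed

lemma not_rdvd_nonint: "u \<notin> \<int> \<Longrightarrow> \<not> real_of_int i rdvd u"
  unfolding rdvd_def by (metis Ints_mult Ints_of_int)

lemma critical_Ifm:
  "MIR.qfree p \<Longrightarrow> qf_vars p \<subseteq> {..<k} \<Longrightarrow> critical x (\<lambda>s. Ifm (map s [0..<k]) p)"
proof (induction p)
  case (Lt a)
  then show ?case using critical_atom[OF locally_form_Inum, of a k "\<lambda>v. v < 0" x] by (simp add: sgn_if)
next
  case (Le a)
  then show ?case using critical_atom[OF locally_form_Inum, of a k "\<lambda>v. v \<le> 0" x] by (simp add: sgn_if)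
next
  case (Gt a)
  then show ?case using critical_atom[OF locally_form_Inum, of a k "\<lambda>v. v > 0" x] by (simp add: sgn_if)
next
  case (Ge a)
  then show ?case using critical_atom[OF locally_form_Inum, of a k "\<lambda>v. v \<ge> 0" x] by (simp add: sgn_if)
next
  case (Eq a)
  then show ?case using critical_atom[OF locally_form_Inum, of a k "\<lambda>v. v = 0" x] by (simp add: sgn_if)
next
  case (NEq a)
  then show ?case using critical_atom[OF locally_form_Inum, of a k "\<lambda>v. v \<noteq> 0" x] by (simp add: sgn_if)
next
  case (Dvd i a)
  then show ?case
    using critical_atom[OF locally_form_Inum, of a k "\<lambda>v. real_of_int i rdvd v" x] by (simp add: not_rdvd_nonint)
next
  case (NDvd i a)
  then show ?case
    using critical_not[OF critical_atom[OF locally_form_Inum, of a k "\<lambda>v. real_of_int i rdvd v" x]]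
    by (simp add: not_rdvd_nonint)
qed (auto intro: critical_const critical_not critical_combine)

lemma dpred_critical:
  assumes "dpred real_plus_less_one_int P"
  shows "critical x P"
proof -
  obtain k p where p: "MIR.qfree p" "qf_vars p \<subseteq> {..<k}" "\<And>s. P s = Ifm (map s [0..<k]) p"
    by (rule dpred_mir[OF assms], rule that)
  have eq: "P = (\<lambda>s. Ifm (map s [0..<k]) p)" by (intro ext p(3))
  show ?thesis unfolding eq by (rule critical_Ifm[OF p(1,2)])
qed

section \<open>Eventual periodicity in one variable\<close>

text \<open>A floor term has a slope that is exact along unit steps and correct up to a bounded
  error globally. Only the bound depends on the other variables, which is why the period will
  not.\<close>

definition slope :: "nat \<Rightarrow> ((nat \<Rightarrow> real) \<Rightarrow> real) \<Rightarrow> int \<Rightarrow> bool" where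
  "slope x f e \<longleftrightarrow> (\<forall>s. f (s(x := s x + 1)) = f s + of_int e) \<and>
     (\<forall>s. \<exists>B. \<forall>y. \<bar>f (s(x := y)) - of_int e * y\<bar> \<le> B)"

lemma slope_const: "slope x (\<lambda>s. c) 0"
  unfolding slope_def by auto

lemma slope_var: "slope x (\<lambda>s. s i) (if i = x then 1 else 0)"
  unfolding slope_def by auto

lemma slope_add:
  assumes "slope x f d" "slope x g e"
  shows "slope x (\<lambda>s. f s + g s) (d + e)"
  unfolding slope_def
proof (intro conjI allI)
  fix s
  show "f (s(x := s x + 1)) + g (s(x := s x + 1)) = f s + g s + of_int (d + e)"
    using assms unfolding slope_def by simp
  obtain B C where "\<And>y. \<bar>f (s(x := y)) - of_int d * y\<bar> \<le> B" "\<And>y. \<bar>g (s(x := y)) - of_int e * y\<bar> \<le> C"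
    using assms unfolding slope_def by meson
  then have "\<bar>f (s(x := y)) + g (s(x := y)) - of_int (d + e) * y\<bar> \<le> B + C" for y
    using abs_triangle_ineq[of "f (s(x := y)) - of_int d * y" "g (s(x := y)) - of_int e * y"]
    by (simp add: algebra_simps) (smt (verit))
  then show "\<exists>B. \<forall>y. \<bar>f (s(x := y)) + g (s(x := y)) - of_int (d + e) * y\<bar> \<le> B" by blast
qed

lemma slope_scale:
  assumes "slope x f e"
  shows "slope x (\<lambda>s. of_int c * f s) (c * e)"
  unfolding slope_def
proof (intro conjI allI)
  fix s
  have "f (s(x := s x + 1)) = f s + of_int e" using assms unfolding slope_def by blast
  then show "of_int c * f (s(x := s x + 1)) = of_int c * f s + of_int (c * e)"
    by (simp only: of_int_mult distrib_left)
  obtain B where B: "\<And>y. \<bar>f (s(x := y)) - of_int e * y\<bar> \<le> B"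
    using assms unfolding slope_def by meson
  have "\<bar>of_int c * f (s(x := y)) - of_int (c * e) * y\<bar> \<le> \<bar>of_int c\<bar> * B" for y
  proof -
    have "of_int c * f (s(x := y)) - of_int (c * e) * y = of_int c * (f (s(x := y)) - of_int e * y)"
      by (simp only: of_int_mult right_diff_distrib mult.assoc)
    then show ?thesis using B[of y] by (simp only: abs_mult) (intro mult_left_mono; simp)
  qed
  then show "\<exists>B. \<forall>y. \<bar>of_int c * f (s(x := y)) - of_int (c * e) * y\<bar> \<le> B" by blast
qed

lemma slope_floor:
  assumes "slope x f e"
  shows "slope x (\<lambda>s. of_int \<lfloor>f s\<rfloor>) e"
  unfolding slope_def
proof (intro conjI allI)
  fix s
  have "f (s(x := s x + 1)) = f s + of_int e" using assms unfolding slope_def by blast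
  then show "of_int \<lfloor>f (s(x := s x + 1))\<rfloor> = of_int \<lfloor>f s\<rfloor> + real_of_int e"
    by (simp only: floor_add_int[symmetric] of_int_add)
  obtain B where B: "\<And>y. \<bar>f (s(x := y)) - of_int e * y\<bar> \<le> B"
    using assms unfolding slope_def by meson
  have "\<bar>of_int \<lfloor>f (s(x := y))\<rfloor> - of_int e * y\<bar> \<le> B + 1" for y
    using B[of y] by linarith
  then show "\<exists>B. \<forall>y. \<bar>of_int \<lfloor>f (s(x := y))\<rfloor> - of_int e * y\<bar> \<le> B" by blast
qed

lemma slope_Inum:
  "num_vars t \<subseteq> {..<k} \<Longrightarrow> \<exists>e. slope x (\<lambda>s. Inum (map s [0..<k]) t) e"
proof (induction t)
  case (C c)
  show ?case using exI[of "slope x _", OF slope_const] by simp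
next
  case (Bound n)
  then show ?case using exI[of "slope x _", OF slope_var[of x n]] by simp
next
  case (CN n c a)
  then obtain e where "slope x (\<lambda>s. Inum (map s [0..<k]) a) e" by auto
  from exI[of "slope x _", OF slope_add[OF slope_scale[OF slope_var[of x n], of c] this]] CN.prems
  show ?case by simp
next
  case (Neg a)
  then obtain e where "slope x (\<lambda>s. Inum (map s [0..<k]) a) e" by auto
  from exI[of "slope x _", OF slope_scale[OF this, of "-1"]] show ?case by simp
next
  case (Add a b)
  then obtain d e where "slope x (\<lambda>s. Inum (map s [0..<k]) a) d" "slope x (\<lambda>s. Inum (map s [0..<k]) b) e"
    by auto
  from exI[of "slope x _", OF slope_add[OF this]] show ?case by simp
next
  case (Sub a b)
  then obtain d e where "slope x (\<lambda>s. Inum (map s [0..<k]) a) d" "slope x (\<lambda>s. Inum (map s [0..<k]) b) e"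
    by auto
  from exI[of "slope x _", OF slope_add[OF this(1) slope_scale[OF this(2), of "-1"]]] show ?case by simp
next
  case (Mul c a)
  then obtain e where "slope x (\<lambda>s. Inum (map s [0..<k]) a) e" by auto
  from exI[of "slope x _", OF slope_scale[OF this, of c]] show ?case by simp
next
  case (Floor a)
  then obtain e where "slope x (\<lambda>s. Inum (map s [0..<k]) a) e" by auto
  from exI[of "slope x _", OF slope_floor[OF this]] show ?case by simp
next
  case (CF c a b)
  then obtain d e where "slope x (\<lambda>s. Inum (map s [0..<k]) a) d" "slope x (\<lambda>s. Inum (map s [0..<k]) b) e"
    by auto
  from exI[of "slope x _", OF slope_add[OF slope_scale[OF slope_floor[OF this(1)], of c] this(2)]] show ?case by simp
qed

definition eventually_periodic :: "nat \<Rightarrow> (real \<Rightarrow> 'a) \<Rightarrow> bool" where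
  "eventually_periodic p f \<longleftrightarrow> (\<exists>T. \<forall>y>T. f (y + of_nat p) = f y)"

lemma eventually_periodic_mult:
  assumes "eventually_periodic p f"
  shows "eventually_periodic (m * p) f"
proof -
  obtain T where T: "\<And>y. y > T \<Longrightarrow> f (y + of_nat p) = f y"
    using assms unfolding eventually_periodic_def by blast
  have "f (y + of_nat (m * p)) = f y" if "y > T" for y
  proof (induction m)
    case (Suc m)
    have "0 \<le> real (m * p)" by simp
    then have "y + real (m * p) > T" using that by linarith
    from T[OF this] show ?case using Suc by (simp add: algebra_simps)
  qed simp
  then show ?thesis unfolding eventually_periodic_def by blast
qed

lemma eventually_periodic_combine:
  assumes "eventually_periodic p f" "eventually_periodic q g"
  shows "eventually_periodic (p * q) (\<lambda>y. h (f y) (g y))"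
proof -
  obtain T where T: "\<And>y. y > T \<Longrightarrow> f (y + of_nat (q * p)) = f y"
    using eventually_periodic_mult[OF assms(1), of q] unfolding eventually_periodic_def by blast
  obtain T' where T': "\<And>y. y > T' \<Longrightarrow> g (y + of_nat (p * q)) = g y"
    using eventually_periodic_mult[OF assms(2), of p] unfolding eventually_periodic_def by blast
  have "h (f (y + of_nat (p * q))) (g (y + of_nat (p * q))) = h (f y) (g y)" if "y > max T T'" for y
    using T[of y] T'[of y] that by (simp add: mult.commute)
  then show ?thesis unfolding eventually_periodic_def by blast
qed

definition uniformly_periodic :: "nat \<Rightarrow> ((nat \<Rightarrow> real) \<Rightarrow> bool) \<Rightarrow> bool" where
  "uniformly_periodic x P \<longleftrightarrow> (\<exists>p>0. \<forall>s. eventually_periodic p (\<lambda>y. P (s(x := y))))"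

lemma uniformly_periodic_combine:
  assumes "uniformly_periodic x P" "uniformly_periodic x P'"
  shows "uniformly_periodic x (\<lambda>s. f (P s) (P' s))"
proof -
  obtain p q where "p > 0" "q > 0" "\<And>s. eventually_periodic p (\<lambda>y. P (s(x := y)))"
    "\<And>s. eventually_periodic q (\<lambda>y. P' (s(x := y)))"
    using assms unfolding uniformly_periodic_def by blast
  then have "p * q > 0" "\<And>s. eventually_periodic (p * q) (\<lambda>y. f (P (s(x := y))) (P' (s(x := y))))"
    by (auto intro: eventually_periodic_combine)
  then show ?thesis unfolding uniformly_periodic_def by blast
qed

lemma uniformly_periodic_const: "uniformly_periodic x (\<lambda>s. b)"
  unfolding uniformly_periodic_def eventually_periodic_def by auto

lemma uniformly_periodic_not: "uniformly_periodic x P \<Longrightarrow> uniformly_periodic x (\<lambda>s. \<not> P s)"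
  using uniformly_periodic_combine[of x P P "\<lambda>a b. \<not> a"] by simp

text \<open>For nonzero \<open>e\<close> the sign settles once \<open>y\<close> exceeds the bound on
  the error; for \<open>e = 0\<close> the function itself has period 1. So 1 is a period in all
  cases.\<close>

lemma uniformly_periodic_sgn:
  assumes "slope x f e" and R: "\<And>u v. sgn u = sgn v \<Longrightarrow> R u = R v"
  shows "uniformly_periodic x (\<lambda>s. R (f s))"
  unfolding uniformly_periodic_def
proof (intro exI[of _ "1::nat"] conjI allI)
  fix s
  have shift: "f (s(x := y + 1)) = f (s(x := y)) + of_int e" for y
  proof -
    have "f ((s(x := y))(x := (s(x := y)) x + 1)) = f (s(x := y)) + of_int e"
      using assms(1) unfolding slope_def by blast
    then show ?thesis by simp
  qed
  obtain B where B: "\<And>y. \<bar>f (s(x := y)) - of_int e * y\<bar> \<le> B"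
    using assms(1) unfolding slope_def by meson
  have "sgn (f (s(x := y + 1))) = sgn (f (s(x := y)))" if y: "y > \<bar>B\<bar>" for y
  proof -
    consider "e = 0" | "e \<ge> 1" | "e \<le> -1" by linarith
    then show ?thesis
    proof cases
      case 1
      then show ?thesis using shift by simp
    next
      case 2
      then have "real_of_int e \<ge> 1" by simp
      then have "real_of_int e * y \<ge> 1 * y" using y by (intro mult_right_mono) auto
      then have "f (s(x := y)) > 0" using B[of y] y by linarith
      moreover have "f (s(x := y + 1)) > 0" using calculation shift[of y] 2 by simp
      ultimately show ?thesis by simp
    next
      case 3
      then have "real_of_int e \<le> -1" by linarith
      then have "real_of_int e * y \<le> -1 * y" using y by (intro mult_right_mono) auto
      then have "f (s(x := y)) < 0" using B[of y] y by linarith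
      moreover have "f (s(x := y + 1)) < 0" using calculation shift[of y] \<open>real_of_int e \<le> -1\<close> by linarith
      ultimately show ?thesis by simp
    qed
  qed
  then show "eventually_periodic 1 (\<lambda>y. R (f (s(x := y))))"
    unfolding eventually_periodic_def by (intro exI[of _ "\<bar>B\<bar>"] allI impI R) simp
qed simp

text \<open>A step of length \<open>|i|\<close> in \<open>x\<close> changes \<open>f\<close> by an
  integer multiple of \<open>i\<close>. Divisibility by 0 means being 0, which is a sign
  condition.\<close>

lemma uniformly_periodic_rdvd:
  assumes "slope x f e"
  shows "uniformly_periodic x (\<lambda>s. real_of_int i rdvd f s)"
proof (cases "i = 0")
  case True
  have "uniformly_periodic x (\<lambda>s. f s = 0)"
    by (rule uniformly_periodic_sgn[OF assms]) (auto simp: sgn_if split: if_splits)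
  then show ?thesis using True by (simp add: rdvd_left_0_eq)
next
  case False
  define p where "p = nat \<bar>i\<bar>"
  have p: "real p = \<bar>real_of_int i\<bar>" by (simp add: p_def)
  have shift: "f (s(x := y + real m)) = f (s(x := y)) + real m * of_int e" for s y m
  proof (induction m)
    case 0
    have eq: "y + real 0 = y" by simp
    show ?case unfolding eq by simp
  next
    case (Suc m)
    have "f ((s(x := y + real m))(x := (s(x := y + real m)) x + 1)) = f (s(x := y + real m)) + of_int e"
      using assms unfolding slope_def by blast
    then have step: "f (s(x := y + real m + 1)) = f (s(x := y + real m)) + of_int e" by simp
    have eq: "y + real (Suc m) = y + real m + 1" by simp
    have "real (Suc m) * of_int e = real m * of_int e + of_int e" by (simp add: distrib_right)
    then show ?case unfolding eq step Suc by (simp only: add.assoc)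
  qed
  have dv: "real_of_int i rdvd u + real_of_int i * of_int d \<longleftrightarrow> real_of_int i rdvd u" for u d
  proof
    assume "real_of_int i rdvd u + real_of_int i * of_int d"
    then obtain k where "u + real_of_int i * of_int d = real_of_int i * of_int k" unfolding rdvd_def by blast
    then have "u = real_of_int i * of_int (k - d)" by (simp add: algebra_simps)
    then show "real_of_int i rdvd u" unfolding rdvd_def by blast
  next
    assume "real_of_int i rdvd u"
    then obtain k where "u = real_of_int i * of_int k" unfolding rdvd_def by blast
    then have "u + real_of_int i * of_int d = real_of_int i * of_int (k + d)" by (simp add: algebra_simps)
    then show "real_of_int i rdvd u + real_of_int i * of_int d" unfolding rdvd_def by blast
  qed
  have "real_of_int i rdvd f (s(x := y + real p)) \<longleftrightarrow> real_of_int i rdvd f (s(x := y))" for s y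
  proof (cases "i > 0")
    case True
    with p have "real p = real_of_int i" by simp
    then show ?thesis unfolding shift using dv[of "f (s(x := y))" e] by simp
  next
    case False
    with p have "real p = - real_of_int i" by simp
    then show ?thesis unfolding shift using dv[of "f (s(x := y))" "- e"] by simp
  qed
  moreover have "p > 0" using False by (simp add: p_def)
  ultimately show ?thesis unfolding uniformly_periodic_def eventually_periodic_def by blast
qed

lemma uniformly_periodic_Ifm:
  "MIR.qfree p \<Longrightarrow> qf_vars p \<subseteq> {..<k} \<Longrightarrow> uniformly_periodic x (\<lambda>s. Ifm (map s [0..<k]) p)"
proof (induction p)
  case (Lt a)
  obtain e where e: "slope x (\<lambda>s. Inum (map s [0..<k]) a) e"
    using slope_Inum[of a k x] Lt.prems by auto
  show ?case unfolding Ifm.simps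
    by (rule uniformly_periodic_sgn[OF e, of "\<lambda>v. v < 0"]) (metis sgn_less)
next
  case (Le a)
  obtain e where e: "slope x (\<lambda>s. Inum (map s [0..<k]) a) e"
    using slope_Inum[of a k x] Le.prems by auto
  show ?case unfolding Ifm.simps
    by (rule uniformly_periodic_sgn[OF e, of "\<lambda>v. v \<le> 0"]) (metis sgn_greater not_less)
next
  case (Gt a)
  obtain e where e: "slope x (\<lambda>s. Inum (map s [0..<k]) a) e"
    using slope_Inum[of a k x] Gt.prems by auto
  show ?case unfolding Ifm.simps
    by (rule uniformly_periodic_sgn[OF e, of "\<lambda>v. v > 0"]) (metis sgn_greater)
next
  case (Ge a)
  obtain e where e: "slope x (\<lambda>s. Inum (map s [0..<k]) a) e"
    using slope_Inum[of a k x] Ge.prems by auto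
  show ?case unfolding Ifm.simps
    by (rule uniformly_periodic_sgn[OF e, of "\<lambda>v. v \<ge> 0"]) (metis sgn_less not_less)
next
  case (Eq a)
  obtain e where e: "slope x (\<lambda>s. Inum (map s [0..<k]) a) e"
    using slope_Inum[of a k x] Eq.prems by auto
  show ?case unfolding Ifm.simps
    by (rule uniformly_periodic_sgn[OF e, of "\<lambda>v. v = 0"]) (metis sgn_eq_0_iff)
next
  case (NEq a)
  obtain e where e: "slope x (\<lambda>s. Inum (map s [0..<k]) a) e"
    using slope_Inum[of a k x] NEq.prems by auto
  show ?case unfolding Ifm.simps
    by (rule uniformly_periodic_sgn[OF e, of "\<lambda>v. v \<noteq> 0"]) (metis sgn_eq_0_iff)
next
  case (Dvd i a)
  obtain e where e: "slope x (\<lambda>s. Inum (map s [0..<k]) a) e"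
    using slope_Inum[of a k x] Dvd.prems by auto
  from uniformly_periodic_rdvd[OF e] show ?case by simp
next
  case (NDvd i a)
  obtain e where e: "slope x (\<lambda>s. Inum (map s [0..<k]) a) e"
    using slope_Inum[of a k x] NDvd.prems by auto
  from uniformly_periodic_not[OF uniformly_periodic_rdvd[OF e]] show ?case by simp
qed (auto intro: uniformly_periodic_const uniformly_periodic_not uniformly_periodic_combine)

lemma dpred_uniformly_periodic:
  assumes "dpred real_plus_less_one_int P"
  shows "uniformly_periodic x P"
proof -
  obtain k p where p: "MIR.qfree p" "qf_vars p \<subseteq> {..<k}" "\<And>s. P s = Ifm (map s [0..<k]) p"
    by (rule dpred_mir[OF assms], rule that)
  have eq: "P = (\<lambda>s. Ifm (map s [0..<k]) p)" by (intro ext p(3))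
  show ?thesis unfolding eq by (rule uniformly_periodic_Ifm[OF p(1,2)])
qed

section \<open>Definable sets of rationals\<close>

lemma int_forms_zero: "g \<in> int_forms \<Longrightarrow> g (\<lambda>_. 0) = 0"
  by (induction rule: int_forms.induct) auto

lemma not_eventually_Rats: "\<not> (\<forall>\<^sub>F y in nhds a. y \<in> \<rat>)" for a :: real
proof
  assume "\<forall>\<^sub>F y in nhds a. y \<in> \<rat>"
  then obtain d where d: "d > 0" "\<And>y. dist y a < d \<Longrightarrow> y \<in> \<rat>"
    unfolding eventually_nhds_metric by blast
  have "{a<..<a + d} \<subseteq> \<rat>" using d(2) by (auto simp: dist_real_def)
  then have "countable {a<..<a + d}" using countable_rat countable_subset by blast
  then show False using d(1) uncountable_open_interval[of a "a + d"] by simp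
qed

text \<open>The generator is the least positive element, because remainders modulo it stay in
  \<open>H\<close>.\<close>

lemma int_subgroup_cyclic:
  fixes H :: "int set"
  assumes diff: "\<And>a b. a \<in> H \<Longrightarrow> b \<in> H \<Longrightarrow> a - b \<in> H" and pos: "m \<in> H" "m > 0"
  obtains h where "h > 0" "\<And>k. k \<in> H \<longleftrightarrow> h dvd k"
proof -
  define h where "h = Gcd H"
  have zero: "0 \<in> H" using diff[OF pos(1) pos(1)] by simp
  have neg: "- a \<in> H" if "a \<in> H" for a using diff[OF zero that] by simp
  have add: "a + b \<in> H" if "a \<in> H" "b \<in> H" for a b using diff[OF that(1) neg[OF that(2)]] by simp
  have mult: "a * of_nat n \<in> H" if "a \<in> H" for a n
    by (induction n) (auto simp: zero algebra_simps intro: add that)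
  have mult_int: "a * n \<in> H" if "a \<in> H" for a n
    using mult[OF that, of "nat n"] mult[OF neg[OF that], of "nat (- n)"]
    by (cases "n \<ge> 0") auto
  define l where "l = (LEAST n. n > 0 \<and> int n \<in> H)"
  have "nat m > 0 \<and> int (nat m) \<in> H" using pos by simp
  then have l: "l > 0" "int l \<in> H"
    unfolding l_def by (metis (mono_tags, lifting) LeastI_ex)+
  have "k \<in> H \<longleftrightarrow> int l dvd k" for k
  proof
    assume k: "k \<in> H"
    have "k mod int l = k - int l * (k div int l)" by (simp add: minus_mult_div_eq_mod)
    then have r: "k mod int l \<in> H" using diff[OF k mult_int[OF l(2)]] by simp
    have "nat (k mod int l) < l" using l(1) by (simp add: nat_less_iff)
    then have "\<not> (nat (k mod int l) > 0 \<and> int (nat (k mod int l)) \<in> H)"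
      unfolding l_def by (rule not_less_Least)
    with r l(1) have "k mod int l = 0" by simp (smt (verit) Euclidean_Rings.pos_mod_sign of_nat_0_less_iff)
    then show "int l dvd k" by auto
  next
    assume "int l dvd k"
    then show "k \<in> H" using mult_int[OF l(2)] by (auto simp: dvd_def)
  qed
  with l(1) that[of "int l"] show ?thesis by simp
qed

section \<open>Structures below the integer structure that do not define the integers\<close>

text \<open>Such structures exist, and they turn out to define semilinear predicates only. The
  contradiction arises later, from the choice of \<open>X\<close>.\<close>

locale intermediate =
  fixes M :: "(fsym, rsym, real) fo_structure"
  assumes affine: "affine_structure M"
    and tame: "dpred M P \<Longrightarrow> dpred real_plus_less_one_int P"
    and no_integers: "\<not> dpred M (\<lambda>s. s 0 \<in> \<int>)"
begin

lemma dpred_mem: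
  assumes "dpred M (\<lambda>s. s j \<in> A)"
  shows "dpred M (\<lambda>s. s i \<in> A)"
proof -
  \<comment> \<open>A transposition rather than a single replacement, as \<open>dpred_rename\<close>
    needs injectivity.\<close>
  have "inj (\<lambda>k. if k = j then i else if k = i then j else k)"
    by (auto simp: inj_def split: if_splits)
  from dpred_rename[OF this assms] show ?thesis by simp
qed

lemma dpred_mem_lin:
  assumes "dpred M (\<lambda>s. s 0 \<in> A)" "e \<in> lin V" "finite V"
  shows "dpred M (\<lambda>s. e s \<in> A)"
proof -
  obtain x where "x \<notin> V" using assms(3) ex_new_if_finite infinite_UNIV_nat by blast
  from dpred_lin_subst[OF affine dpred_mem[OF assms(1), of x] assms(2,3) this] show ?thesis by simp
qed

text \<open>If no critical form were an integer at \<open>a\<close>, a neighbourhood of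
  \<open>a\<close> would lie in the set, contradicting countability of the rationals. On the axis
  each critical form is \<open>c * a\<close> with a nonzero integer \<open>c\<close>, and
  \<open>N\<close> is the product of the absolute values of these factors.\<close>

lemma rational_set_denominator:
  assumes A: "dpred M (\<lambda>s. s 0 \<in> A)" "A \<subseteq> \<rat>"
  obtains N :: int where "N > 0" "\<And>a. a \<in> A \<Longrightarrow> of_int N * a \<in> \<int>"
proof -
  obtain Q where Q: "Q \<subseteq> moving_forms 0" "finite Q"
    "\<And>s. \<forall>g\<in>Q. g s \<notin> \<int> \<Longrightarrow> \<forall>\<^sub>F y in nhds (s 0). ((s(0 := y)) 0 \<in> A) = (s 0 \<in> A)"
    using dpred_critical[OF tame[OF A(1)], of 0] unfolding critical_def by metis
  have "\<forall>g\<in>Q. \<exists>c::int. c \<noteq> 0 \<and> (\<forall>a. g ((\<lambda>_. 0)(0 := a)) = of_int c * a)"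
  proof
    fix g assume "g \<in> Q"
    then obtain c :: int where c: "g \<in> int_forms" "c \<noteq> 0"
      "\<And>s y. g (s(0 := y)) = g s + of_int c * (y - s 0)"
      using Q(1) unfolding moving_forms_def by blast
    have "g ((\<lambda>_. 0)(0 := a)) = of_int c * a" for a
      unfolding c(3) by (simp add: int_forms_zero[OF c(1)])
    with c(2) show "\<exists>c::int. c \<noteq> 0 \<and> (\<forall>a. g ((\<lambda>_. 0)(0 := a)) = of_int c * a)" by blast
  qed
  then obtain c :: "((nat \<Rightarrow> real) \<Rightarrow> real) \<Rightarrow> int"
    where c: "\<And>g. g \<in> Q \<Longrightarrow> c g \<noteq> 0" "\<And>g a. g \<in> Q \<Longrightarrow> g ((\<lambda>_. 0)(0 := a)) = of_int (c g) * a"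
    using bchoice[of Q "\<lambda>g c. c \<noteq> 0 \<and> (\<forall>a. g ((\<lambda>_. 0)(0 := a)) = of_int c * a)"] by blast
  define N where "N = (\<Prod>g\<in>Q. \<bar>c g\<bar>)"
  have "N > 0" unfolding N_def using c(1) by (intro prod_pos) auto
  moreover have "of_int N * a \<in> \<int>" if a: "a \<in> A" for a
  proof -
    have "\<exists>g\<in>Q. g ((\<lambda>_. 0)(0 := a)) \<in> \<int>"
    proof (rule ccontr)
      assume "\<not> ?thesis"
      then have "\<forall>\<^sub>F y in nhds a. (y \<in> A) = (a \<in> A)" using Q(3)[of "(\<lambda>_. 0)(0 := a)"] by simp
      then have "\<forall>\<^sub>F y in nhds a. y \<in> \<rat>" by eventually_elim (use a A(2) in auto)
      then show False using not_eventually_Rats by blast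
    qed
    then obtain g where g: "g \<in> Q" "of_int (c g) * a \<in> \<int>" using c(2) by auto
    have "\<bar>c g\<bar> dvd N" unfolding N_def by (rule dvd_prodI[OF Q(2) g(1)])
    then have "c g dvd N" by simp
    then obtain d where "N = c g * d" by (auto simp only: dvd_def)
    then have "of_int N * a = of_int d * (of_int (c g) * a)" by simp
    then show ?thesis using g(2) by (metis Ints_mult Ints_of_int)
  qed
  ultimately show ?thesis using that by blast
qed

text \<open>
  If \<open>A\<close> were unbounded, its group of eventual periods would be nontrivial and discrete, and
  rescaling it by a rational factor would define the integers.
\<close>

lemma rational_set_bounded_above:
  assumes A: "dpred M (\<lambda>s. s 0 \<in> A)" "A \<subseteq> \<rat>"
  shows "\<exists>T. \<forall>a\<in>A. a \<le> T"
proof (rule ccontr)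
  assume "\<not> ?thesis"
  then have unbounded: "\<exists>a\<in>A. T < a" for T by (meson not_le)
  obtain N where N: "N > 0" "\<And>a. a \<in> A \<Longrightarrow> of_int N * a \<in> \<int>"
    by (rule rational_set_denominator[OF A], rule that)
  have "uniformly_periodic 0 (\<lambda>s. s 0 \<in> A)" by (rule dpred_uniformly_periodic[OF tame[OF A(1)]])
  then obtain p where p: "p > 0" "eventually_periodic p (\<lambda>y. y \<in> A)"
    unfolding uniformly_periodic_def fun_upd_same by auto
  define G where "G = {t. \<exists>T. \<forall>y>T. (y + t \<in> A) = (y \<in> A)}"
  have pG: "of_nat p \<in> G" using p(2) unfolding G_def eventually_periodic_def by simp
  have G_diff: "t - u \<in> G" if t: "t \<in> G" and u: "u \<in> G" for t u
  proof -
    obtain T where T: "\<forall>y>T. (y + t \<in> A) = (y \<in> A)"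
      using t unfolding G_def by auto
    obtain U where U: "\<forall>y>U. (y + u \<in> A) = (y \<in> A)"
      using u unfolding G_def by auto
    \<comment> \<open>Both periodicities are applied at \<open>y - u\<close>, hence the shift of the
      thresholds by \<open>u\<close>.\<close>
    have "(y + (t - u) \<in> A) = (y \<in> A)" if "y > max (T + u) (U + u)" for y
      using T[rule_format, of "y - u"] U[rule_format, of "y - u"] that
      by (simp add: algebra_simps)
    then show ?thesis unfolding G_def by blast
  qed
  \<comment> \<open>An element of \<open>A\<close> beyond the threshold and its translate by
    \<open>t\<close> both have denominator \<open>N\<close>; this is where unboundedness is
    used.\<close>
  have G_denominator: "of_int N * t \<in> \<int>" if t: "t \<in> G" for t
  proof -
    obtain T where T: "\<forall>y>T. (y + t \<in> A) = (y \<in> A)" using t unfolding G_def by auto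
    obtain a where "a \<in> A" "T < a" using unbounded by blast
    then have "of_int N * (a + t) \<in> \<int>" "of_int N * a \<in> \<int>" using T N(2) by auto
    then have "of_int N * (a + t) - of_int N * a \<in> \<int>" by (rule Ints_diff)
    then show ?thesis by (simp add: algebra_simps)
  qed
  \<comment> \<open>Scaling by \<open>N\<close> makes \<open>G\<close> a subgroup of the integers.
    It is cyclic, and dividing by its generator turns \<open>G\<close> into the integers.\<close>
  define H where "H = {k. of_int k / of_int N \<in> G}"
  have H_diff: "a - b \<in> H" if "a \<in> H" "b \<in> H" for a b
    using G_diff[of "of_int a / of_int N" "of_int b / of_int N"] that
    unfolding H_def by (simp add: diff_divide_distrib)
  have NpH: "N * int p \<in> H" "N * int p > 0" using N(1) pG p(1) unfolding H_def by auto
  obtain h where h: "h > 0" "\<And>k. k \<in> H \<longleftrightarrow> h dvd k"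
    by (rule int_subgroup_cyclic[of H, OF H_diff NpH], assumption+, rule that)
  have integer_iff: "(of_int h / of_int N) * z \<in> G \<longleftrightarrow> z \<in> \<int>" for z :: real
  proof
    assume "z \<in> \<int>"
    then obtain k where k: "z = of_int k" by (auto elim: Ints_cases)
    have "h * k \<in> H" using h(2) by simp
    then show "(of_int h / of_int N) * z \<in> G" unfolding H_def k by simp
  next
    assume z: "(of_int h / of_int N) * z \<in> G"
    have "of_int h * z \<in> \<int>" using G_denominator[OF z] N(1) by simp
    then obtain k where k: "of_int h * z = of_int k" by (auto elim: Ints_cases)
    then have "k \<in> H" using z unfolding H_def by simp
    then obtain m where "k = h * m" using h(2) by (auto simp: dvd_def)
    with k h(1) have "z = of_int m" by simp
    then show "z \<in> \<int>" by simp
  qed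
  \<comment> \<open>Variable 0 holds the candidate period, 1 the threshold and 2 the point; the last
    two are quantified next.\<close>
  have "dpred M (\<lambda>s. s 1 < s 2 \<longrightarrow> (s 2 + s 0 \<in> A) = (s 2 \<in> A))"
    by (intro dpred_imp dpred_iff dpred_less[OF affine, of _ "{0, 1, 2}"]
        dpred_mem_lin[OF A(1), of _ "{0, 1, 2}"] lin_add lin_var) auto
  from dpred_ex[OF dpred_all[OF this, of 2], of 1] have G: "dpred M (\<lambda>s. s 0 \<in> G)"
    unfolding G_def by simp
  have "(\<lambda>s. (of_int h / of_int N) * s 0) \<in> lin {0}" by (intro lin_scale lin_var) auto
  from dpred_mem_lin[OF G this] have "dpred M (\<lambda>s. s 0 \<in> \<int>)" unfolding integer_iff by simp
  with no_integers show False by contradiction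
qed

text \<open>A lower bound comes from the reflected set, and only finitely many multiples of
  \<open>1 / N\<close> lie in a bounded interval.\<close>

lemma rational_set_finite:
  assumes A: "dpred M (\<lambda>s. s 0 \<in> A)" "A \<subseteq> \<rat>"
  shows "finite A"
proof -
  obtain N where N: "N > 0" "\<And>a. a \<in> A \<Longrightarrow> of_int N * a \<in> \<int>"
    by (rule rational_set_denominator[OF A], rule that)
  obtain T where T: "\<And>a. a \<in> A \<Longrightarrow> a \<le> T" using rational_set_bounded_above[OF A] by blast
  have "(\<lambda>s. (-1) * s 0) \<in> lin {0}" by (intro lin_scale lin_var) auto
  from dpred_mem_lin[OF A(1) this] have "dpred M (\<lambda>s. s 0 \<in> uminus -` A)" by simp
  moreover have "uminus -` A \<subseteq> \<rat>"
  proof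
    fix a assume "a \<in> uminus -` A"
    then have "- a \<in> \<rat>" using A(2) by auto
    then show "a \<in> \<rat>" by simp
  qed
  ultimately obtain U where "\<And>a. a \<in> uminus -` A \<Longrightarrow> a \<le> U"
    using rational_set_bounded_above by blast
  from this[of "- a" for a] have U: "\<And>a. a \<in> A \<Longrightarrow> - a \<le> U" by simp
  have "A \<subseteq> (\<lambda>k. of_int k / of_int N) ` {\<lfloor>of_int N * (- U)\<rfloor>..\<lceil>of_int N * T\<rceil>}"
  proof
    fix a assume a: "a \<in> A"
    obtain k where k: "of_int N * a = of_int k" using N(2)[OF a] by (auto elim: Ints_cases)
    have "- U \<le> a" using U[OF a] by simp
    then have "of_int N * (- U) \<le> of_int N * a" "of_int N * a \<le> of_int N * T"
      using N(1) T[OF a] by (intro mult_left_mono; simp)+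
    then have "k \<in> {\<lfloor>of_int N * (- U)\<rfloor>..\<lceil>of_int N * T\<rceil>}"
      unfolding k atLeastAtMost_iff by linarith
    moreover have "a = of_int k / of_int N" using k N(1) by (simp add: field_simps)
    ultimately show "a \<in> (\<lambda>k. of_int k / of_int N) ` {\<lfloor>of_int N * (- U)\<rfloor>..\<lceil>of_int N * T\<rceil>}" by blast
  qed
  then show ?thesis using finite_subset by blast
qed

end

section \<open>Generic points\<close>

text \<open>Coordinates outside \<open>V\<close> are frozen, not merely unconstrained: they act as
  parameters, later in particular the offset stored in \<open>x\<close>.\<close>

definition nearby :: "nat set \<Rightarrow> (nat \<Rightarrow> real) \<Rightarrow> ((nat \<Rightarrow> real) \<Rightarrow> bool) \<Rightarrow> bool" where
  "nearby V s R \<longleftrightarrow>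
     (\<exists>d>0. \<forall>t. (\<forall>i\<in>V. \<bar>t i - s i\<bar> < d) \<longrightarrow> (\<forall>i. i \<notin> V \<longrightarrow> t i = s i) \<longrightarrow> R t)"

lemma nearbyI:
  "d > 0 \<Longrightarrow> (\<And>t. (\<And>i. i \<in> V \<Longrightarrow> \<bar>t i - s i\<bar> < d) \<Longrightarrow> (\<And>i. i \<notin> V \<Longrightarrow> t i = s i) \<Longrightarrow> R t) \<Longrightarrow>
     nearby V s R"
  unfolding nearby_def by blast

lemma nearbyE:
  assumes "nearby V s R"
  obtains d where "d > 0"
    "\<forall>t. (\<forall>i\<in>V. \<bar>t i - s i\<bar> < d) \<longrightarrow> (\<forall>i. i \<notin> V \<longrightarrow> t i = s i) \<longrightarrow> R t"
  using assms unfolding nearby_def by blast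

lemma nearby_mono:
  assumes "nearby V s R" "\<And>t. (\<And>i. i \<notin> V \<Longrightarrow> t i = s i) \<Longrightarrow> R t \<Longrightarrow> R' t"
  shows "nearby V s R'"
  using assms unfolding nearby_def by meson

lemma nearby_ball:
  "finite G \<Longrightarrow> (\<And>g. g \<in> G \<Longrightarrow> nearby V s (R g)) \<Longrightarrow> nearby V s (\<lambda>t. \<forall>g\<in>G. R g t)"
proof (induction G rule: finite_induct)
  case empty
  show ?case by (rule nearbyI[of 1]) auto
next
  case (insert g G)
  have n: "nearby V s (\<lambda>t. \<forall>g\<in>G. R g t)" "nearby V s (R g)" using insert by simp_all
  obtain d where d: "d > 0"
    "\<forall>t. (\<forall>i\<in>V. \<bar>t i - s i\<bar> < d) \<longrightarrow> (\<forall>i. i \<notin> V \<longrightarrow> t i = s i) \<longrightarrow> (\<forall>g\<in>G. R g t)"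
    using n(1) by (rule nearbyE)
  obtain e where e: "e > 0"
    "\<forall>t. (\<forall>i\<in>V. \<bar>t i - s i\<bar> < e) \<longrightarrow> (\<forall>i. i \<notin> V \<longrightarrow> t i = s i) \<longrightarrow> R g t"
    using n(2) by (rule nearbyE)
  show ?case
  proof (rule nearbyI[of "min d e"])
    show "min d e > 0" using d e by simp
    fix t assume "\<And>i. i \<in> V \<Longrightarrow> \<bar>t i - s i\<bar> < min d e" "\<And>i. i \<notin> V \<Longrightarrow> t i = s i"
    then show "\<forall>g\<in>insert g G. R g t" using d(2)[rule_format, of t] e(2)[rule_format, of t] by simp
  qed
qed

lemma nearby_lin_sgn:
  assumes "g \<in> lin V" "finite V" "g s \<noteq> 0"
  shows "nearby V s (\<lambda>t. sgn (g t) = sgn (g s))"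
proof -
  have "\<bar>g s\<bar> > 0" using assms(3) by simp
  from lin_continuous[OF assms(1,2) this] obtain d where d: "d > 0"
    "\<And>t. (\<And>i. i \<in> V \<Longrightarrow> \<bar>t i - s i\<bar> < d) \<Longrightarrow> \<bar>g t - g s\<bar> < \<bar>g s\<bar>" by blast
  show ?thesis
  proof (rule nearbyI[OF d(1)])
    fix t assume "\<And>i. i \<in> V \<Longrightarrow> \<bar>t i - s i\<bar> < d"
    then have "\<bar>g t - g s\<bar> < \<bar>g s\<bar>" by (rule d(2))
    then show "sgn (g t) = sgn (g s)" by (auto simp: sgn_if)
  qed
qed

lemma nearby_Rats:
  assumes "nearby V s R"
  obtains t where "\<And>i. i \<in> V \<Longrightarrow> t i \<in> \<rat>" "\<And>i. i \<notin> V \<Longrightarrow> t i = s i" "R t"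
proof -
  obtain d where d: "d > 0"
    "\<forall>t. (\<forall>i\<in>V. \<bar>t i - s i\<bar> < d) \<longrightarrow> (\<forall>i. i \<notin> V \<longrightarrow> t i = s i) \<longrightarrow> R t"
    using assms by (rule nearbyE)
  have "\<exists>q\<in>\<rat>. \<bar>q - s i\<bar> < d" for i
  proof -
    obtain p where "p \<in> \<rat>" "s i < p" "p < s i + d"
      using Rats_dense_in_real[of "s i" "s i + d"] d(1) by auto
    then show ?thesis by (intro bexI[of _ p]) auto
  qed
  then obtain q where q: "\<And>i. q i \<in> \<rat>" "\<And>i. \<bar>q i - s i\<bar> < d" by metis
  show ?thesis
    by (rule that[of "\<lambda>i. if i \<in> V then q i else s i"]) (auto simp: q intro!: d(2)[rule_format])
qed

text \<open>
  Equivalently, \<open>1\<close> and the coordinates \<open>s i\<close> for \<open>i \<in> V\<close> are linearly independent over the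
  rationals.
\<close>

definition generic :: "nat set \<Rightarrow> (nat \<Rightarrow> real) \<Rightarrow> bool" where
  "generic V s \<longleftrightarrow> (\<forall>g\<in>lin V. g s = 0 \<longrightarrow> (\<forall>t. g t = 0))"

lemma genericD: "generic V s \<Longrightarrow> g \<in> lin V \<Longrightarrow> g s = 0 \<Longrightarrow> g t = 0"
  unfolding generic_def by blast

lemma generic_cong: "generic V s \<Longrightarrow> (\<And>i. i \<in> V \<Longrightarrow> s i = t i) \<Longrightarrow> generic V t"
  unfolding generic_def using lin_cong[of _ V t s] by metis

text \<open>Leaves room to choose a further coordinate that satisfies no rational relation with the
  earlier ones.\<close>

lemma countable_lin_values:
  "finite V \<Longrightarrow> countable ((\<lambda>g. g t) ` lin V)"
proof (induction V rule: finite_induct)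
  case empty
  have "(\<lambda>g. g t) ` lin {} \<subseteq> \<rat>" by (auto intro: lin_Rats)
  then show ?case using countable_rat countable_subset by blast
next
  case (insert x V)
  have "(\<lambda>g. g t) ` lin (insert x V) \<subseteq> (\<lambda>(c, b). c * t x + b) ` (\<rat> \<times> (\<lambda>g. g t) ` lin V)"
  proof
    fix b assume "b \<in> (\<lambda>g. g t) ` lin (insert x V)"
    then obtain g where g: "g \<in> lin (insert x V)" "b = g t" by blast
    obtain c h where h: "c \<in> \<rat>" "h \<in> lin V" "\<And>s. g s = c * s x + h s"
      by (rule lin_split[OF g(1) insert.hyps(1,2)], rule that)
    then have "b = (\<lambda>(c, b). c * t x + b) (c, h t)" using g(2) by simp
    then show "b \<in> (\<lambda>(c, b). c * t x + b) ` (\<rat> \<times> (\<lambda>g. g t) ` lin V)"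
      using h(1,2) by blast
  qed
  moreover have "countable ((\<lambda>(c, b). c * t x + b) ` (\<rat> \<times> (\<lambda>g. g t) ` lin V))"
    by (intro countable_image countable_SIGMA countable_rat insert.IH)
  ultimately show ?case using countable_subset by blast
qed

lemma avoid_countable:
  fixes a b :: real
  assumes "countable S" "a < b"
  obtains y where "a < y" "y < b" "y \<notin> S"
proof -
  have "\<not> {a<..<b} \<subseteq> S"
    using uncountable_open_interval[of a b] assms countable_subset by blast
  then obtain y where "y \<in> {a<..<b}" "y \<notin> S" by blast
  with that[of y] show ?thesis by simp
qed

text \<open>The coordinates are perturbed one after another. A new value \<open>y\<close> has to
  avoid the countably many solutions of \<open>c * y + b = 0\<close> with \<open>c\<close> rational
  and \<open>b\<close> a value of a form in the earlier coordinates.\<close>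

lemma generic_dense:
  assumes "finite V" "d > 0"
  shows "\<exists>t. generic V t \<and> (\<forall>i\<in>V. \<bar>t i - s i\<bar> < d) \<and> (\<forall>i. i \<notin> V \<longrightarrow> t i = s i)"
  using assms(1)
proof (induction V rule: finite_induct)
  case empty
  have "generic {} s" unfolding generic_def using lin_cong[of _ "{}"] by (metis empty_iff)
  then show ?case by blast
next
  case (insert x V)
  then obtain t where t: "generic V t" "\<And>i. i \<in> V \<Longrightarrow> \<bar>t i - s i\<bar> < d" "\<And>i. i \<notin> V \<Longrightarrow> t i = s i"
    by blast
  \<comment> \<open>Pairs with \<open>c = 0\<close> only add the harmless value 0, since division by
    zero yields zero.\<close>
  have "countable ((\<lambda>(c, b). - b / c) ` (\<rat> \<times> (\<lambda>g. g t) ` lin V))"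
    by (intro countable_image countable_SIGMA countable_rat countable_lin_values insert.hyps)
  then obtain y where y: "s x < y" "y < s x + d"
    "y \<notin> (\<lambda>(c, b). - b / c) ` (\<rat> \<times> (\<lambda>g. g t) ` lin V)"
    by (rule avoid_countable[of _ "s x" "s x + d"]) (use assms(2) in auto)
  have "generic (insert x V) (t(x := y))"
    unfolding generic_def
  proof (intro ballI impI allI)
    fix g u assume g: "g \<in> lin (insert x V)" "g (t(x := y)) = 0"
    obtain c h where h: "c \<in> \<rat>" "h \<in> lin V" "\<And>s. g s = c * s x + h s"
      by (rule lin_split[OF g(1) insert.hyps(1,2)], rule that)
    have ht: "c * y + h t = 0" using g(2) lin_upd[OF h(2) insert.hyps(2)] by (simp add: h(3))
    have "c = 0"
    proof (rule ccontr)
      assume "c \<noteq> 0"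
      with ht have "y = (\<lambda>(c, b). - b / c) (c, h t)" by (simp add: field_simps)
      with y(3) h(1,2) show False by blast
    qed
    with ht have "h t = 0" by simp
    from genericD[OF t(1) h(2) this] \<open>c = 0\<close> show "g u = 0" by (simp add: h(3))
  qed
  moreover have "\<forall>i\<in>insert x V. \<bar>(t(x := y)) i - s i\<bar> < d" using t(2) y(1,2) by auto
  moreover have "\<forall>i. i \<notin> insert x V \<longrightarrow> (t(x := y)) i = s i" using t(3) by simp
  ultimately show ?case by blast
qed

lemma nearby_generic:
  assumes "finite V" "nearby V s R"
  obtains t where "generic V t" "R t"
proof -
  obtain d where d: "d > 0"
    "\<forall>t. (\<forall>i\<in>V. \<bar>t i - s i\<bar> < d) \<longrightarrow> (\<forall>i. i \<notin> V \<longrightarrow> t i = s i) \<longrightarrow> R t"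
    using assms(2) by (rule nearbyE)
  from generic_dense[OF assms(1) d(1), of s] that d(2) show ?thesis by metis
qed

text \<open>At a generic point each form is either identically zero or nonzero, so all signs are
  stable in a neighbourhood.\<close>

lemma sl_nearby_generic:
  assumes "finite V" "sl V P" "generic V s"
  shows "nearby V s (\<lambda>t. P t = P s)"
proof -
  obtain G where G: "G \<subseteq> lin V" "finite G" "\<And>s t. \<forall>g\<in>G. sgn (g s) = sgn (g t) \<Longrightarrow> P s = P t"
    using assms(2) unfolding sl_def by metis
  have near: "nearby V s (\<lambda>t. sgn (g t) = sgn (g s))" if g: "g \<in> G" for g
  proof (cases "g s = 0")
    case True
    then have "g t = g s" for t using genericD[OF assms(3), of g] g G(1) by auto
    then have eq: "sgn (g t) = sgn (g s)" for t by metis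
    show ?thesis by (rule nearbyI[of 1]) (simp, rule eq)
  next
    case False
    then show ?thesis using nearby_lin_sgn[of g V s] g G(1) assms(1) by blast
  qed
  have "nearby V s (\<lambda>t. \<forall>g\<in>G. sgn (g t) = sgn (g s))" by (rule nearby_ball[OF G(2) near])
  then show ?thesis
  proof (rule nearby_mono)
    fix t assume "\<forall>g\<in>G. sgn (g t) = sgn (g s)"
    then show "P t = P s" by (rule G(3))
  qed
qed

text \<open>If no nontrivial form vanished at a point of \<open>P\<close>, all signs and hence
  \<open>P\<close> would persist in a neighbourhood, which contains a generic point.\<close>

lemma sl_no_generic:
  assumes V: "finite V" and P: "sl V P" "\<And>t. generic V t \<Longrightarrow> \<not> P t"
  obtains G where "finite G" "G \<subseteq> lin V" "\<And>g. g \<in> G \<Longrightarrow> \<exists>t. g t \<noteq> 0"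
    "\<And>s. P s \<Longrightarrow> \<exists>g\<in>G. g s = 0"
proof -
  obtain G where G: "G \<subseteq> lin V" "finite G" "\<And>s t. \<forall>g\<in>G. sgn (g s) = sgn (g t) \<Longrightarrow> P s = P t"
    using P(1) unfolding sl_def by metis
  have "\<exists>g\<in>{g \<in> G. \<exists>t. g t \<noteq> 0}. g s = 0" if s: "P s" for s
  proof (rule ccontr)
    assume n: "\<not> ?thesis"
    have near: "nearby V s (\<lambda>t. sgn (g t) = sgn (g s))" if g: "g \<in> G" for g
    proof (cases "g s = 0")
      case True
      then have "g t = g s" for t using n g by auto
      then have eq: "sgn (g t) = sgn (g s)" for t by metis
      show ?thesis by (rule nearbyI[of 1]) (simp, rule eq)
    next
      case False
      then show ?thesis using nearby_lin_sgn[of g V s] g G(1) V by blast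
    qed
    have "nearby V s (\<lambda>t. \<forall>g\<in>G. sgn (g t) = sgn (g s))" by (rule nearby_ball[OF G(2) near])
    then obtain t where "generic V t" "\<forall>g\<in>G. sgn (g t) = sgn (g s)"
      by (rule nearby_generic[OF V])
    with G(3)[of t s] P(2)[of t] s show False by blast
  qed
  with G(1,2) show ?thesis by (intro that[of "{g \<in> G. \<exists>t. g t \<noteq> 0}"]) auto
qed

text \<open>A form with a zero that is not identically zero is not constant, so some variable has a
  nonzero coefficient.\<close>

lemma lin_solve:
  assumes "g \<in> lin V" "finite V" "g s = 0" "g t \<noteq> 0"
  obtains j e where "j \<in> V" "e \<in> lin (V - {j})" "\<And>u. g u = 0 \<longleftrightarrow> u j = e u"
proof -
  obtain c d where 1: "\<And>i. c i \<in> \<rat>" "d \<in> \<rat>" "\<And>s. g s = d + (\<Sum>i\<in>V. c i * s i)"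
    using assms(1) by (rule linE) blast
  have "\<exists>j\<in>V. c j \<noteq> 0"
  proof (rule ccontr)
    assume "\<not> ?thesis"
    then have "g u = d" for u by (simp add: 1(3))
    with assms(3,4) show False by simp
  qed
  then obtain j where j: "j \<in> V" "c j \<noteq> 0" by blast
  define e where "e u = (-1 / c j) * (d + (\<Sum>i\<in>V - {j}. c i * u i))" for u
  have "e \<in> lin (V - {j})" unfolding e_def using 1 by (intro lin_scale linI) auto
  moreover have "g u = 0 \<longleftrightarrow> u j = e u" for u
  proof -
    have "g u = c j * u j + (d + (\<Sum>i\<in>V - {j}. c i * u i))"
      unfolding 1(3) using sum.remove[OF assms(2) j(1), of "\<lambda>i. c i * u i"] by simp
    then show ?thesis using j(2) unfolding e_def by (auto simp: field_simps)
  qed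
  ultimately show ?thesis using that j(1) by blast
qed

text \<open>Test points for eliminating a variable: the roots cut the line into points and open
  intervals, and finitely many forms meet every cell, whatever the parameters.\<close>

lemma lin_sample_points:
  assumes "finite R" "R \<subseteq> lin V"
  obtains E where "finite E" "E \<subseteq> lin V"
    "\<And>s a. \<exists>e\<in>E. \<forall>r\<in>R. sgn (a - r s) = sgn (e s - r s)"
proof -
  \<comment> \<open>Roots for point cells, midpoints for bounded intervals, shifts by 1 for
    unbounded ones, and the zero form in case there are no roots.\<close>
  define E where "E = {\<lambda>s. 0} \<union> R \<union> (\<lambda>r s. r s + 1) ` R \<union> (\<lambda>r s. r s - 1) ` R \<union>
    (\<lambda>(r, r') s. (r s + r' s) / 2) ` (R \<times> R)"
  have "finite E" unfolding E_def using assms(1) by simp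
  moreover have "E \<subseteq> lin V"
    unfolding E_def using assms(2)
    by (auto intro!: lin_const lin_add lin_diff lin_divide)
  moreover have "\<exists>e\<in>E. \<forall>r\<in>R. sgn (a - r s) = sgn (e s - r s)" for s and a :: real
  proof (cases "\<exists>r\<in>R. r s = a")
    case True
    then show ?thesis unfolding E_def by blast
  next
    case ne: False
    define L where "L = {r \<in> R. r s < a}"
    define U where "U = {r \<in> R. a < r s}"
    have LU: "finite L" "finite U" "R = L \<union> U"
      using assms(1) ne unfolding L_def U_def by (auto simp: linorder_neq_iff)
    have low: "\<exists>l\<in>L. \<forall>r\<in>L. r s \<le> l s" if "L \<noteq> {}"
    proof -
      have "Max ((\<lambda>r. r s) ` L) \<in> (\<lambda>r. r s) ` L" using that LU(1) by (intro Max_in) auto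
      then obtain l where "l \<in> L" "Max ((\<lambda>r. r s) ` L) = l s" by auto
      moreover have "\<forall>r\<in>L. r s \<le> l s" if "Max ((\<lambda>r. r s) ` L) = l s"
        unfolding that[symmetric] using LU(1) by auto
      ultimately show ?thesis by blast
    qed
    have up: "\<exists>u\<in>U. \<forall>r\<in>U. u s \<le> r s" if "U \<noteq> {}"
    proof -
      have "Min ((\<lambda>r. r s) ` U) \<in> (\<lambda>r. r s) ` U" using that LU(2) by (intro Min_in) auto
      then obtain u where "u \<in> U" "Min ((\<lambda>r. r s) ` U) = u s" by auto
      moreover have "\<forall>r\<in>U. u s \<le> r s" if "Min ((\<lambda>r. r s) ` U) = u s"
        unfolding that[symmetric] using LU(2) by auto
      ultimately show ?thesis by blast
    qed
    have "\<exists>e\<in>E. (\<forall>r\<in>L. r s < e s) \<and> (\<forall>r\<in>U. e s < r s)"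
    proof (cases "L = {}"; cases "U = {}")
      assume "L = {}" "U = {}"
      then show ?thesis unfolding E_def by blast
    next
      assume "L = {}" "U \<noteq> {}"
      with up obtain u where u: "u \<in> U" "\<forall>r\<in>U. u s \<le> r s" by blast
      have "(\<lambda>s. u s - 1) \<in> E" using u(1) LU(3) unfolding E_def by blast
      moreover have "\<forall>r\<in>U. u s - 1 < r s" using u(2) by fastforce
      ultimately show ?thesis using \<open>L = {}\<close> by (intro bexI[of _ "\<lambda>s. u s - 1"]) auto
    next
      assume "L \<noteq> {}" "U = {}"
      with low obtain l where l: "l \<in> L" "\<forall>r\<in>L. r s \<le> l s" by blast
      have "(\<lambda>s. l s + 1) \<in> E" using l(1) LU(3) unfolding E_def by blast
      moreover have "\<forall>r\<in>L. r s < l s + 1" using l(2) by fastforce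
      ultimately show ?thesis using \<open>U = {}\<close> by (intro bexI[of _ "\<lambda>s. l s + 1"]) auto
    next
      assume "L \<noteq> {}" "U \<noteq> {}"
      with low up obtain l u where l: "l \<in> L" "\<forall>r\<in>L. r s \<le> l s" and u: "u \<in> U" "\<forall>r\<in>U. u s \<le> r s"
        by blast
      have "(\<lambda>(r, r') s. (r s + r' s) / 2) (l, u) \<in> E"
        using l(1) u(1) LU(3) unfolding E_def by blast
      then have "(\<lambda>s. (l s + u s) / 2) \<in> E" by simp
      moreover have "l s < u s" using l(1) u(1) unfolding L_def U_def by auto
      then have "\<forall>r\<in>L. r s < (l s + u s) / 2" "\<forall>r\<in>U. (l s + u s) / 2 < r s"
        using l(2) u(2) by fastforce+
      ultimately show ?thesis by (intro bexI[of _ "\<lambda>s. (l s + u s) / 2"]) auto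
    qed
    then obtain e where e: "e \<in> E" "\<forall>r\<in>L. r s < e s" "\<forall>r\<in>U. e s < r s" by blast
    have "sgn (a - r s) = sgn (e s - r s)" if "r \<in> R" for r
      using that e(2,3) unfolding LU(3) by (auto simp: L_def U_def)
    with e(1) show ?thesis by blast
  qed
  ultimately show ?thesis using that by blast
qed

text \<open>A form with nonzero coefficient in \<open>x\<close> changes its sign along
  \<open>x\<close> only at its root, and the other forms are constant along \<open>x\<close>. Away
  from the roots all signs are stable, hence so is \<open>P\<close>.\<close>

lemma sl_fiber_roots:
  assumes V: "finite V" "x \<notin> V" and P: "sl (insert x V) P"
  obtains R where "finite R" "R \<subseteq> lin V"
    "\<And>s. \<not> (\<forall>\<^sub>F y in nhds (s x). P (s(x := y)) = P s) \<Longrightarrow> \<exists>r\<in>R. s x = r s"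
proof -
  obtain G where G: "G \<subseteq> lin (insert x V)" "finite G"
    "\<And>s t. \<forall>g\<in>G. sgn (g s) = sgn (g t) \<Longrightarrow> P s = P t"
    using P unfolding sl_def by metis
  have "\<forall>g\<in>G. \<exists>r\<in>lin V. \<exists>c. \<forall>s. if c = 0 then g s = r s else g s = c * (s x - r s)"
  proof
    fix g assume "g \<in> G"
    with G(1) have g: "g \<in> lin (insert x V)" by blast
    obtain c h where h: "c \<in> \<rat>" "h \<in> lin V" "\<And>s. g s = c * s x + h s"
      by (rule lin_split[OF g V], rule that)
    show "\<exists>r\<in>lin V. \<exists>c. \<forall>s. if c = 0 then g s = r s else g s = c * (s x - r s)"
    proof (cases "c = 0")
      case True
      then show ?thesis using h by auto
    next
      case False
      have "(\<lambda>s. (- 1 / c) * h s) \<in> lin V" using h by (intro lin_scale) auto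
      moreover have "g s = c * (s x - (- 1 / c) * h s)" for s using False by (simp add: h(3) field_simps)
      ultimately show ?thesis using False by (intro bexI[of _ "\<lambda>s. (- 1 / c) * h s"] exI[of _ c]) auto
    qed
  qed
  then obtain r where r: "\<And>g. g \<in> G \<Longrightarrow> r g \<in> lin V"
    "\<And>g. g \<in> G \<Longrightarrow> \<exists>c. \<forall>s. if c = 0 then g s = r g s else g s = c * (s x - r g s)"
    by metis
  show ?thesis
  proof (rule that[of "r ` G"])
    show "finite (r ` G)" "r ` G \<subseteq> lin V" using G(2) r(1) by auto
    fix s assume np: "\<not> (\<forall>\<^sub>F y in nhds (s x). P (s(x := y)) = P s)"
    show "\<exists>r\<in>r ` G. s x = r s"
    proof (rule ccontr)
      assume n: "\<not> ?thesis"
      have "\<forall>\<^sub>F y in nhds (s x). sgn (g (s(x := y))) = sgn (g s)" if g: "g \<in> G" for g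
      proof -
        obtain c where c: "\<And>s. if c = 0 then g s = r g s else g s = c * (s x - r g s)"
          using r(2)[OF g] by blast
        have upd: "r g (s(x := y)) = r g s" for y by (rule lin_upd[OF r(1)[OF g] V(2)])
        show ?thesis
        proof (cases "c = 0")
          case True
          then have "g u = r g u" for u using c[of u] by simp
          then show ?thesis by (simp add: upd)
        next
          case False
          then have gc: "g u = c * (u x - r g u)" for u using c[of u] by simp
          have ne: "s x \<noteq> r g s" using n g by blast
          have "\<forall>\<^sub>F y in nhds (s x). sgn (y - r g s) = sgn (s x - r g s)"
          proof (cases "s x < r g s")
            case True
            then have "\<forall>\<^sub>F y in nhds (s x). y < r g s" by (rule order_tendstoD(2)[OF filterlim_ident])
            then show ?thesis by eventually_elim (use True in simp)
          next
            case False
            with ne have l: "r g s < s x" by simp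
            then have "\<forall>\<^sub>F y in nhds (s x). r g s < y" by (rule order_tendstoD(1)[OF filterlim_ident])
            then show ?thesis by eventually_elim (use l in simp)
          qed
          then show ?thesis by eventually_elim (simp add: gc upd sgn_mult)
        qed
      qed
      then have "\<forall>\<^sub>F y in nhds (s x). \<forall>g\<in>G. sgn (g (s(x := y))) = sgn (g s)"
        using G(2) by (simp add: eventually_ball_finite)
      then have "\<forall>\<^sub>F y in nhds (s x). P (s(x := y)) = P s"
        by eventually_elim (rule G(3))
      with np show False by contradiction
    qed
  qed
qed

section \<open>Definable predicates are semilinear\<close>

lemma nearby_single: "nearby {x} s R \<longleftrightarrow> (\<forall>\<^sub>F y in nhds (s x). R (s(x := y)))"
proof
  assume "nearby {x} s R"
  then obtain d where d: "d > 0"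
    "\<forall>t. (\<forall>i\<in>{x}. \<bar>t i - s i\<bar> < d) \<longrightarrow> (\<forall>i. i \<notin> {x} \<longrightarrow> t i = s i) \<longrightarrow> R t"
    by (rule nearbyE)
  have "R (s(x := y))" if "dist y (s x) < d" for y
    using that by (intro d(2)[rule_format]) (auto simp: dist_real_def)
  with d(1) show "\<forall>\<^sub>F y in nhds (s x). R (s(x := y))" unfolding eventually_nhds_metric by blast
next
  assume "\<forall>\<^sub>F y in nhds (s x). R (s(x := y))"
  then obtain d where d: "d > 0" "\<And>y. dist y (s x) < d \<Longrightarrow> R (s(x := y))"
    unfolding eventually_nhds_metric by blast
  show "nearby {x} s R"
  proof (rule nearbyI[OF d(1)])
    fix t assume t: "\<And>i. i \<in> {x} \<Longrightarrow> \<bar>t i - s i\<bar> < d" "\<And>i. i \<notin> {x} \<Longrightarrow> t i = s i"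
    have "s(x := t x) = t" using t(2) by auto
    moreover have "R (s(x := t x))" using t(1) by (intro d(2)) (simp add: dist_real_def)
    ultimately show "R t" by simp
  qed
qed

definition fibre_stable :: "nat \<Rightarrow> ((nat \<Rightarrow> real) \<Rightarrow> bool) \<Rightarrow> (nat \<Rightarrow> real) \<Rightarrow> bool" where
  "fibre_stable x P s \<longleftrightarrow> (\<forall>\<^sub>F y in nhds (s x). P (s(x := y)) = P s)"

lemma fibre_stable_supported: "supported W P \<Longrightarrow> x \<in> W \<Longrightarrow> supported W (fibre_stable x P)"
proof -
  assume P: "supported W P" and x: "x \<in> W"
  have "fibre_stable x P s = fibre_stable x P t" if st: "\<forall>i\<in>W. s i = t i" for s t
  proof -
    have "P (s(x := y)) = P (t(x := y))" for y by (rule supportedD[OF P]) (use st in auto)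
    moreover have "P s = P t" by (rule supportedD[OF P]) (use st in auto)
    ultimately show ?thesis unfolding fibre_stable_def using st x by simp
  qed
  then show ?thesis unfolding supported_def by blast
qed

text \<open>A locally constant function on a connected set is constant.\<close>

lemma fibre_stable_segment:
  assumes "\<And>y. min (s x) b \<le> y \<Longrightarrow> y \<le> max (s x) b \<Longrightarrow> fibre_stable x P (s(x := y))"
  shows "P (s(x := b)) = P s"
proof -
  define I where "I = {min (s x) b..max (s x) b}"
  have "P (s(x := s x)) = P (s(x := b))"
  proof (rule connected_local_const[of I "s x" b "\<lambda>y. P (s(x := y))"])
    show "connected I" "s x \<in> I" "b \<in> I" unfolding I_def by (auto simp: connected_Icc)
    show "\<forall>a\<in>I. \<forall>\<^sub>F c in at a within I. P (s(x := a)) = P (s(x := c))"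
    proof
      fix a assume "a \<in> I"
      then have "fibre_stable x P (s(x := a))" using assms unfolding I_def by auto
      then have "\<forall>\<^sub>F c in nhds a. P (s(x := c)) = P (s(x := a))" unfolding fibre_stable_def by simp
      then have "\<forall>\<^sub>F c in nhds a. c \<noteq> a \<longrightarrow> c \<in> I \<longrightarrow> P (s(x := a)) = P (s(x := c))"
        by eventually_elim auto
      then show "\<forall>\<^sub>F c in at a within I. P (s(x := a)) = P (s(x := c))"
        unfolding eventually_at_filter .
    qed
  qed
  then show ?thesis by simp
qed

text \<open>Between roots \<open>P\<close> is constant along \<open>x\<close>, so its value is that
  at a sample form in the same cell, where \<open>x\<close> no longer occurs. The signs of finitely
  many forms tell which sample fits and which value it gives.\<close>

lemma sl_from_roots:
  assumes V: "finite V" "x \<notin> V" and P: "supported (insert x V) P"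
    and R: "finite R" "R \<subseteq> lin V" "\<And>s. \<not> fibre_stable x P s \<Longrightarrow> \<exists>r\<in>R. s x = r s"
    and sub: "\<And>e. e \<in> lin V \<Longrightarrow> sl V (\<lambda>s. P (s(x := e s)))"
  shows "sl (insert x V) P"
proof -
  obtain E where E: "finite E" "E \<subseteq> lin V"
    "\<And>s a. \<exists>e\<in>E. \<forall>r\<in>R. sgn (a - r s) = sgn (e s - r s)"
    by (rule lin_sample_points[OF R(1,2)], rule that)
  have "\<forall>e\<in>E. \<exists>G\<subseteq>lin V. finite G \<and>
     (\<forall>s t. (\<forall>g\<in>G. sgn (g s) = sgn (g t)) \<longrightarrow> P (s(x := e s)) = P (t(x := e t)))"
    using sub E(2) unfolding sl_def by blast
  then obtain G where G: "\<And>e. e \<in> E \<Longrightarrow> G e \<subseteq> lin V" "\<And>e. e \<in> E \<Longrightarrow> finite (G e)"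
    "\<And>e. e \<in> E \<Longrightarrow> \<forall>s t. (\<forall>g\<in>G e. sgn (g s) = sgn (g t)) \<longrightarrow> P (s(x := e s)) = P (t(x := e t))"
    by metis
  \<comment> \<open>Three groups: forms deciding \<open>P\<close> at the samples, the position of
    \<open>x\<close> among the roots, and the position of the samples among the roots.\<close>
  define H where "H = (\<Union>e\<in>E. G e) \<union> (\<lambda>r s. s x - r s) ` R \<union> (\<lambda>(e, r) s. e s - r s) ` (E \<times> R)"
  have cell: "P (s(x := b)) = P s" if b: "\<And>r. r \<in> R \<Longrightarrow> sgn (s x - r s) = sgn (b - r s)" for s b
  proof (cases "\<exists>r\<in>R. s x = r s")
    case True
    then obtain r where "r \<in> R" "s x = r s" by blast
    with b[of r] have "b = s x" by (simp add: sgn_0_0)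
    then show ?thesis by simp
  next
    case False
    show ?thesis
    proof (rule fibre_stable_segment)
      fix y assume y: "min (s x) b \<le> y" "y \<le> max (s x) b"
      show "fibre_stable x P (s(x := y))"
      proof (rule ccontr)
        assume "\<not> ?thesis"
        then obtain r where r: "r \<in> R" "(s(x := y)) x = r (s(x := y))" using R(3) by blast
        then have "y = r s" using lin_upd[of r V x s y] R(2) V(2) by auto
        moreover have "s x \<noteq> r s" using False r(1) by blast
        ultimately show False using b[OF r(1)] y by (auto simp: sgn_if min_def max_def split: if_splits)
      qed
    qed
  qed
  show ?thesis unfolding sl_def
  proof (intro exI[of _ H] conjI allI impI)
    have lin: "g \<in> lin (insert x V)" if "g \<in> lin V" for g
      using lin_mono[OF that] V(1) by blast
    have "(\<lambda>s. s x - r s) \<in> lin (insert x V)" if "r \<in> R" for r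
      using that R(2) V(1) by (intro lin_diff[OF lin_var lin]) auto
    moreover have "(\<lambda>s. e s - r s) \<in> lin (insert x V)" if "e \<in> E" "r \<in> R" for e r
      using that R(2) E(2) by (intro lin lin_diff) auto
    moreover have "g \<in> lin (insert x V)" if "e \<in> E" "g \<in> G e" for e g
      using that G(1) lin by blast
    ultimately show "H \<subseteq> lin (insert x V)" unfolding H_def by auto
    show "finite H" unfolding H_def using G(2) R(1) E(1) by auto
    fix s t assume st: "\<forall>g\<in>H. sgn (g s) = sgn (g t)"
    \<comment> \<open>The sample found for \<open>s\<close> also lies in the cell of
      \<open>t\<close>, as all relevant signs agree.\<close>
    obtain e where e: "e \<in> E" "\<And>r. r \<in> R \<Longrightarrow> sgn (s x - r s) = sgn (e s - r s)"
      using E(3)[of "s x" s] by blast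
    have "P s = P (s(x := e s))" using cell[of s "e s"] e(2) by simp
    also have "\<dots> = P (t(x := e t))"
    proof -
      have "\<forall>g\<in>G e. sgn (g s) = sgn (g t)" using st e(1) unfolding H_def by blast
      then show ?thesis using G(3)[OF e(1)] by blast
    qed
    also have "\<dots> = P t"
    proof (rule cell)
      fix r assume r: "r \<in> R"
      have "(\<lambda>s. s x - r s) \<in> H" using r unfolding H_def by blast
      with st have 1: "sgn (s x - r s) = sgn (t x - r t)" by fastforce
      have "(\<lambda>(e, r) s. e s - r s) (e, r) \<in> H" using r e(1) unfolding H_def by blast
      then have "(\<lambda>s. e s - r s) \<in> H" by simp
      with st have 2: "sgn (e s - r s) = sgn (e t - r t)" by fastforce
      from 1 2 e(2)[OF r] show "sgn (t x - r t) = sgn (e t - r t)" by simp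
    qed
    finally show "P s = P t" .
  qed
qed

text \<open>A moving form is \<open>a * x + h\<close> with a nonzero integer \<open>a\<close>; where
  it takes an integer value, \<open>x\<close> differs from the root \<open>- h / a\<close> by a
  rational. Which rational is left open, so each root stands for infinitely many parallel
  hyperplanes.\<close>

lemma critical_roots:
  assumes V: "finite V" "x \<notin> V" and P: "dpred real_plus_less_one_int P" "supported (insert x V) P"
  obtains R where "finite R" "R \<subseteq> lin V"
    "\<And>s. \<not> fibre_stable x P s \<Longrightarrow> \<exists>r\<in>R. s x - r s \<in> \<rat>"
proof -
  \<comment> \<open>\<open>P\<close> does not see the remaining variables, so they may be set to 0;
    this brings the critical forms into \<open>lin\<close>.\<close>
  define restrict where "restrict s = (\<lambda>i. if i \<in> insert x V then s i else 0)" for s :: "nat \<Rightarrow> real"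
  have restrict_upd: "restrict (s(x := y)) = (restrict s)(x := y)" for s y
    unfolding restrict_def by auto
  obtain Q where Q: "Q \<subseteq> moving_forms x" "finite Q" "\<And>s. \<forall>g\<in>Q. g s \<notin> \<int> \<Longrightarrow> fibre_stable x P s"
    using dpred_critical[OF P(1), of x] unfolding critical_def fibre_stable_def by metis
  have "\<forall>g\<in>Q. \<exists>r\<in>lin V. \<forall>s. g (restrict s) \<in> \<int> \<longrightarrow> s x - r s \<in> \<rat>"
  proof
    fix g assume "g \<in> Q"
    then obtain a :: int where g: "g \<in> int_forms" "a \<noteq> 0"
      "\<And>s y. g (s(x := y)) = g s + of_int a * (y - s x)"
      using Q(1) unfolding moving_forms_def by blast
    have "(\<lambda>s. g (restrict s)) \<in> lin (insert x V)"
      unfolding restrict_def using V by (intro int_forms_restrict g) auto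
    then obtain c h where h: "h \<in> lin V" "\<And>s. g (restrict s) = c * s x + h s"
      by (rule lin_split[OF _ V]) blast
    have upd: "h (s(x := y)) = h s" for s y by (rule lin_upd[OF h(1) V(2)])
    \<comment> \<open>Comparing \<open>x = 0\<close> with \<open>x = 1\<close> identifies the
      coefficient \<open>c\<close> with the integer slope \<open>a\<close>.\<close>
    have "g (restrict ((\<lambda>_. 0)(x := 1))) = g (restrict (\<lambda>_. 0)) + of_int a"
      unfolding restrict_upd g(3) by (simp add: restrict_def)
    then have c: "c = of_int a" unfolding h(2) upd by simp
    have "(\<lambda>s. (- 1 / of_int a) * h s) \<in> lin V" using h(1) by (intro lin_scale) auto
    moreover have "s x - (- 1 / of_int a) * h s \<in> \<rat>" if i: "g (restrict s) \<in> \<int>" for s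
    proof -
      have "s x - (- 1 / of_int a) * h s = g (restrict s) / of_int a"
        unfolding h(2) c using g(2) by (simp add: field_simps)
      then show ?thesis using i by (auto intro!: Rats_divide elim!: Ints_cases)
    qed
    ultimately show "\<exists>r\<in>lin V. \<forall>s. g (restrict s) \<in> \<int> \<longrightarrow> s x - r s \<in> \<rat>"
      by (intro bexI[of _ "\<lambda>s. (- 1 / of_int a) * h s"]) auto
  qed
  then obtain r where r: "\<And>g. g \<in> Q \<Longrightarrow> r g \<in> lin V"
    "\<And>g s. g \<in> Q \<Longrightarrow> g (restrict s) \<in> \<int> \<Longrightarrow> s x - r g s \<in> \<rat>"
    by metis
  show ?thesis
  proof (rule that[of "r ` Q"])
    show "finite (r ` Q)" "r ` Q \<subseteq> lin V" using Q(2) r(1) by auto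
    fix s assume s: "\<not> fibre_stable x P s"
    have "fibre_stable x P (restrict s) = fibre_stable x P s"
      by (rule supportedD[OF fibre_stable_supported[OF P(2)]]) (auto simp: restrict_def)
    with s Q(3) obtain g where "g \<in> Q" "g (restrict s) \<in> \<int>" by blast
    with r(2) show "\<exists>r\<in>r ` Q. s x - r s \<in> \<rat>" by blast
  qed
qed

section \<open>Definability of local conditions and finiteness of the set of roots\<close>

context intermediate
begin

text \<open>The quantifier over boxes is unwound one coordinate at a time. \<open>N W\<close> is the
  stage where the coordinates in \<open>W\<close> are quantified. The radius sits in a fresh
  variable \<open>z\<close>, and a new value passes through a fresh \<open>w\<close>, so that the
  centre \<open>s i\<close> stays available for comparison.\<close>

lemma dpred_nearby:
  assumes F: "dpred M F" and V: "finite V"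
  shows "dpred M (\<lambda>s. nearby V s F)"
proof -
  obtain S where S: "finite S" "supported S F" using dpred_supported[OF F] by blast
  obtain z where z: "z \<notin> S \<union> V" using S(1) V ex_new_if_finite[of "S \<union> V"] infinite_UNIV_nat by auto
  obtain w where w: "w \<notin> insert z (S \<union> V)"
    using S(1) V ex_new_if_finite[of "insert z (S \<union> V)"] infinite_UNIV_nat by auto
  define N where "N W s \<longleftrightarrow> (\<forall>t. (\<forall>i\<in>W. \<bar>t i - s i\<bar> < s z) \<longrightarrow> F (override_on s t W))" for W s
  have F_upd: "F (override_on (s(i := a)) t W) = F (override_on s t W)" if "i \<notin> S" for s i a t W
    using that by (intro supportedD[OF S(2)]) (auto simp: override_on_def)
  have "dpred M (N W)" if "finite W" "W \<subseteq> V" for W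
    using that
  proof (induction W rule: finite_induct)
    case empty
    have "N {} = F" unfolding N_def by auto
    then show ?case using F by simp
  next
    case (insert i W)
    have iw: "i \<noteq> w" "i \<noteq> z" "z \<noteq> w" "w \<notin> W" "z \<notin> W" "w \<notin> S" using insert.prems w z by auto
    have "(\<lambda>s. s w) \<in> lin {w}" by (intro lin_var) auto
    moreover have "dpred M (N W)" using insert by blast
    ultimately have "dpred M (\<lambda>s. N W (s(i := s w)))"
      using dpred_lin_subst[OF affine, of "N W" "\<lambda>s. s w" "{w}" i] iw by simp
    then have "dpred M (\<lambda>s. (s w - s i < s z \<and> s i - s w < s z) \<longrightarrow> N W (s(i := s w)))" (is "dpred M ?Q")
      by (intro dpred_imp dpred_conj dpred_less[OF affine, of _ "{w, i, z}"] lin_diff lin_var) auto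
    from dpred_all[OF this, of w] have "dpred M (\<lambda>s. \<forall>a. ?Q (s(w := a)))" .
    moreover have "(\<forall>a. ?Q (s(w := a))) = N (insert i W) s" for s
    proof -
      have N_upd: "N W (u(w := a)) = N W u" for u a
        unfolding N_def F_upd[OF iw(6)] using iw by (metis fun_upd_other)
      have "?Q (s(w := a)) \<longleftrightarrow> (\<bar>a - s i\<bar> < s z \<longrightarrow> N W (s(i := a)))" for a
      proof -
        have "(s(w := a))(i := (s(w := a)) w) = (s(i := a))(w := a)" using iw by auto
        then show ?thesis using iw by (simp only: N_upd) (auto simp: abs_less_iff)
      qed
      moreover have "(\<forall>a. \<bar>a - s i\<bar> < s z \<longrightarrow> N W (s(i := a))) = N (insert i W) s"
      proof
        assume l: "\<forall>a. \<bar>a - s i\<bar> < s z \<longrightarrow> N W (s(i := a))"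
        show "N (insert i W) s" unfolding N_def
        proof (intro allI impI)
          fix t assume t: "\<forall>j\<in>insert i W. \<bar>t j - s j\<bar> < s z"
          then have "N W (s(i := t i))" using l by simp
          moreover have "\<forall>j\<in>W. \<bar>t j - (s(i := t i)) j\<bar> < (s(i := t i)) z"
            using t insert.hyps(2) iw by auto
          ultimately have "F (override_on (s(i := t i)) t W)" unfolding N_def by blast
          moreover have "override_on (s(i := t i)) t W = override_on s t (insert i W)"
            by (auto simp: override_on_def)
          ultimately show "F (override_on s t (insert i W))" by simp
        qed
      next
        assume r: "N (insert i W) s"
        show "\<forall>a. \<bar>a - s i\<bar> < s z \<longrightarrow> N W (s(i := a))" unfolding N_def
        proof (intro allI impI)
          fix a t assume a: "\<bar>a - s i\<bar> < s z" and t: "\<forall>j\<in>W. \<bar>t j - (s(i := a)) j\<bar> < (s(i := a)) z"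
          have "\<forall>j\<in>insert i W. \<bar>(t(i := a)) j - s j\<bar> < s z"
            using a t insert.hyps(2) iw by auto
          then have "F (override_on s (t(i := a)) (insert i W))" using r unfolding N_def by blast
          moreover have "override_on s (t(i := a)) (insert i W) = override_on (s(i := a)) t W"
            using insert.hyps(2) by (auto simp: override_on_def)
          ultimately show "F (override_on (s(i := a)) t W)" by simp
        qed
      qed
      ultimately show ?thesis by simp
    qed
    ultimately show ?case by simp
  qed
  then have "dpred M (N V)" using V by blast
  then have "dpred M (\<lambda>s. 0 < s z \<and> N V s)"
    by (intro dpred_conj dpred_pos[OF affine, of _ "{z}"] lin_var) auto
  from dpred_ex[OF this, of z] have "dpred M (\<lambda>s. \<exists>d. 0 < d \<and> N V (s(z := d)))" by simp
  moreover have "(\<exists>d. 0 < d \<and> N V (s(z := d))) = nearby V s F" for s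
  proof -
    have zS: "z \<notin> S" using z by blast
    have NV: "N V (s(z := d)) \<longleftrightarrow> (\<forall>t. (\<forall>i\<in>V. \<bar>t i - s i\<bar> < d) \<longrightarrow> F (override_on s t V))" for d
    proof -
      have "(s(z := d)) i = s i" if "i \<in> V" for i using that z by auto
      then show ?thesis unfolding N_def F_upd[OF zS] by simp
    qed
    have "(\<forall>t. (\<forall>i\<in>V. \<bar>t i - s i\<bar> < d) \<longrightarrow> F (override_on s t V)) \<longleftrightarrow>
        (\<forall>t. (\<forall>i\<in>V. \<bar>t i - s i\<bar> < d) \<longrightarrow> (\<forall>i. i \<notin> V \<longrightarrow> t i = s i) \<longrightarrow> F t)" for d
    proof (intro iffI allI impI)
      fix t assume l: "\<forall>t. (\<forall>i\<in>V. \<bar>t i - s i\<bar> < d) \<longrightarrow> F (override_on s t V)"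
        and t: "\<forall>i\<in>V. \<bar>t i - s i\<bar> < d" "\<forall>i. i \<notin> V \<longrightarrow> t i = s i"
      have "override_on s t V = t" using t(2) by (auto simp: override_on_def)
      with l t(1) show "F t" by metis
    next
      fix t assume r: "\<forall>t. (\<forall>i\<in>V. \<bar>t i - s i\<bar> < d) \<longrightarrow> (\<forall>i. i \<notin> V \<longrightarrow> t i = s i) \<longrightarrow> F t"
        and t: "\<forall>i\<in>V. \<bar>t i - s i\<bar> < d"
      show "F (override_on s t V)"
        by (rule r[rule_format]) (use t in \<open>auto simp: override_on_def\<close>)
    qed
    then show ?thesis unfolding nearby_def NV by simp
  qed
  ultimately show ?thesis by simp
qed

lemma dpred_fibre_stable:
  assumes "dpred M P"
  shows "dpred M (fibre_stable x P)"
proof -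
  have "fibre_stable x P = (\<lambda>s. (P s \<and> nearby {x} s P) \<or> (\<not> P s \<and> nearby {x} s (\<lambda>t. \<not> P t)))"
  proof
    fix s
    show "fibre_stable x P s = ((P s \<and> nearby {x} s P) \<or> (\<not> P s \<and> nearby {x} s (\<lambda>t. \<not> P t)))"
      unfolding fibre_stable_def nearby_single by (cases "P s") simp_all
  qed
  then show ?thesis
    by (simp only:) (intro dpred_disj dpred_conj dpred_neg dpred_nearby assms finite.intros)
qed

text \<open>The new value of \<open>x\<close> depends on \<open>x\<close> itself, which
  \<open>dpred_lin_subst\<close> does not allow; it is parked in a fresh variable first.\<close>

lemma dpred_shear:
  assumes F: "dpred M F" and r: "r \<in> lin V" and V: "finite V" "x \<notin> V"
  shows "dpred M (\<lambda>s. F (s(x := r s + s x)))"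
proof -
  obtain S where S: "finite S" "supported S F" using dpred_supported[OF F] by blast
  obtain z where z: "z \<notin> insert x (S \<union> V)"
    using S(1) V ex_new_if_finite[of "insert x (S \<union> V)"] infinite_UNIV_nat by auto
  have "(\<lambda>s. s z) \<in> lin {z}" by (intro lin_var) auto
  then have "dpred M (\<lambda>s. F (s(x := s z)))"
    by (rule dpred_lin_subst[OF affine F]) (use z in auto)
  moreover have "dpred M (\<lambda>s. s z = r s + s x)"
    by (rule dpred_eq[OF affine, of _ "insert z (insert x V)"])
       (use V in \<open>auto intro!: lin_var lin_add lin_mono[OF r]\<close>)
  ultimately have "dpred M (\<lambda>s. s z = r s + s x \<and> F (s(x := s z)))" by (intro dpred_conj)
  from dpred_ex[OF this, of z]
  have "dpred M (\<lambda>s. \<exists>a. a = r (s(z := a)) + (s(z := a)) x \<and> F ((s(z := a))(x := a)))" by simp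
  moreover have "r (s(z := a)) = r s" for s a using z by (intro lin_upd[OF r]) auto
  moreover have "(s(z := a)) x = s x" for s :: "nat \<Rightarrow> real" and a using z by auto
  moreover have "F ((s(z := a))(x := a)) = F (s(x := a))" for s a
    using z by (intro supportedD[OF S(2)]) auto
  ultimately show ?thesis by simp
qed

text \<open>
  For a root function \<open>r\<close> of \<open>critical_roots\<close>, the offsets \<open>q\<close> such that \<open>x = r + q\<close> is a
  hypersurface of changes over some open set form a definable set of rationals, hence a
  finite one. The remaining changes project to a semilinear set without generic points,
  where a linear relation eliminates one of the other variables.
\<close>

lemma change_roots:
  assumes V: "finite V" "x \<notin> V" and P: "dpred M P" "supported (insert x V) P"
    and IH: "\<And>W F. finite W \<Longrightarrow> card W \<le> card V \<Longrightarrow> dpred M F \<Longrightarrow> supported W F \<Longrightarrow> sl W F"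
  obtains R where "finite R" "R \<subseteq> lin V" "\<And>s. \<not> fibre_stable x P s \<Longrightarrow> \<exists>r\<in>R. s x = r s"
proof -
  obtain R0 where R0: "finite R0" "R0 \<subseteq> lin V"
    "\<And>s. \<not> fibre_stable x P s \<Longrightarrow> \<exists>r\<in>R0. s x - r s \<in> \<rat>"
    by (rule critical_roots[OF V tame[OF P(1)] P(2)], rule that)
  have r_upd: "r (s(x := a)) = r s" if "r \<in> R0" for r s a
    using that R0(2) V(2) by (intro lin_upd) auto
  have R0_upd: "\<exists>r\<in>R0. a - r s \<in> \<rat>" if u: "\<not> fibre_stable x P (s(x := a))" for s a
  proof -
    obtain r where r: "r \<in> R0" "(s(x := a)) x - r (s(x := a)) \<in> \<rat>" using R0(3)[OF u] by blast
    from r(2) have "a - r s \<in> \<rat>" unfolding r_upd[OF r(1)] by simp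
    with r(1) show ?thesis by blast
  qed
  define B where "B s \<longleftrightarrow> \<not> fibre_stable x P s" for s
  have B: "dpred M B" unfolding B_def by (intro dpred_neg dpred_fibre_stable P)
  have B_supp: "supported (insert x V) B"
    using fibre_stable_supported[OF P(2), of x] unfolding B_def supported_def by blast
  \<comment> \<open>Here the coordinate \<open>x\<close> stores an offset \<open>q\<close>:
    \<open>\<Phi> r\<close> says that changes occur along \<open>x = r + q\<close> over a whole
    neighbourhood in \<open>V\<close>.\<close>
  define \<Phi> where "\<Phi> r s \<longleftrightarrow> nearby V s (\<lambda>t. B (t(x := r t + t x)))" for r s
  have \<Phi>: "dpred M (\<Phi> r)" if "r \<in> R0" for r
    unfolding \<Phi>_def using that R0(2) V by (intro dpred_nearby dpred_shear[OF B]) auto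
  define I where "I r = {s x |s. \<Phi> r s}" for r
  have \<Phi>_I: "\<Phi> r t" if r: "r \<in> R0" and s: "\<Phi> r s" and st: "\<And>i. i \<in> insert x V \<Longrightarrow> s i = t i" for r s t
  proof -
    obtain d where d: "d > 0"
      "\<forall>u. (\<forall>i\<in>V. \<bar>u i - s i\<bar> < d) \<longrightarrow> (\<forall>i. i \<notin> V \<longrightarrow> u i = s i) \<longrightarrow> B (u(x := r u + u x))"
      using s unfolding \<Phi>_def by (rule nearbyE)
    show ?thesis unfolding \<Phi>_def
    proof (rule nearbyI[OF d(1)])
      fix u assume u: "\<And>i. i \<in> V \<Longrightarrow> \<bar>u i - t i\<bar> < d" "\<And>i. i \<notin> V \<Longrightarrow> u i = t i"
      define u' where "u' = override_on s u V"
      have "B (u'(x := r u' + u' x))"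
        using u(1) st by (intro d(2)[rule_format]) (auto simp: u'_def override_on_def)
      moreover have "r u' = r u"
        using r R0(2) by (intro lin_cong[of r V]) (auto simp: u'_def)
      moreover have "u' x = u x" using u(2)[OF V(2)] st[of x] V(2) by (simp add: u'_def)
      moreover have "B (u'(x := a)) = B (u(x := a))" for a
        by (rule supportedD[OF B_supp]) (auto simp: u'_def)
      ultimately show "B (u(x := r u + u x))" by simp
    qed
  qed
  have I_finite: "finite (I r)" and I_Rats: "I r \<subseteq> \<rat>" if r: "r \<in> R0" for r
  proof -
    show "I r \<subseteq> \<rat>"
    proof
      fix q assume "q \<in> I r"
      then obtain s where s: "q = s x" "nearby V s (\<lambda>t. B (t(x := r t + t x)))"
        unfolding I_def \<Phi>_def by blast
      \<comment> \<open>At a nearby point with rational coordinates in \<open>V\<close>, both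
        \<open>r\<close> and the root \<open>r'\<close> responsible for the change take rational
        values, which leaves \<open>q\<close> rational.\<close>
      obtain t where t: "\<And>i. i \<in> V \<Longrightarrow> t i \<in> \<rat>" "\<And>i. i \<notin> V \<Longrightarrow> t i = s i" "B (t(x := r t + t x))"
        by (rule nearby_Rats[OF s(2)], rule that)
      obtain r' where r': "r' \<in> R0" "r t + t x - r' t \<in> \<rat>"
        using R0_upd[of t "r t + t x"] t(3) unfolding B_def by blast
      have "f t \<in> \<rat>" if "f \<in> R0" for f using lin_Rats[of f V t] that R0(2) t(1) by blast
      then have rt: "r t \<in> \<rat>" "r' t \<in> \<rat>" using r r'(1) by simp_all
      have "(r t + t x - r' t) - r t + r' t \<in> \<rat>"
        by (rule Rats_add[OF Rats_diff[OF r'(2) rt(1)] rt(2)])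
      then show "q \<in> \<rat>" using t(2)[OF V(2)] s(1) by simp
    qed
    \<comment> \<open>Quantifying away the coordinates in \<open>V\<close> defines
      \<open>I r\<close>, so the finiteness of definable sets of rationals applies.\<close>
    have "dpred M (\<lambda>s. \<exists>t. (\<forall>i. i \<notin> V \<longrightarrow> t i = s i) \<and> \<Phi> r t)"
      by (intro dpred_ex_many V \<Phi> r)
    moreover have "(\<exists>t. (\<forall>i. i \<notin> V \<longrightarrow> t i = s i) \<and> \<Phi> r t) \<longleftrightarrow> s x \<in> I r" for s
    proof
      assume "\<exists>t. (\<forall>i. i \<notin> V \<longrightarrow> t i = s i) \<and> \<Phi> r t"
      then obtain t where "t x = s x" "\<Phi> r t" using V(2) by blast
      then show "s x \<in> I r" unfolding I_def by (metis (mono_tags, lifting) mem_Collect_eq)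
    next
      assume "s x \<in> I r"
      then obtain t where t: "s x = t x" "\<Phi> r t" unfolding I_def by blast
      have "\<Phi> r (override_on s t V)"
        using t(1) V(2) by (intro \<Phi>_I[OF r t(2)]) (auto simp: override_on_def)
      then show "\<exists>t. (\<forall>i. i \<notin> V \<longrightarrow> t i = s i) \<and> \<Phi> r t"
        by (intro exI[of _ "override_on s t V"]) auto
    qed
    ultimately have "dpred M (\<lambda>s. s x \<in> I r)" by simp
    from rational_set_finite[OF dpred_mem[OF this] \<open>I r \<subseteq> \<rat>\<close>] show "finite (I r)" .
  qed
  define R1 where "R1 = (\<Union>r\<in>R0. (\<lambda>q s. r s + q) ` I r)"
  have R1: "finite R1" unfolding R1_def using R0(1) I_finite by blast
  have "(\<lambda>s. r s + q) \<in> lin V" if "r \<in> R0" "q \<in> I r" for r q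
    using that R0(2) I_Rats by (intro lin_add lin_const) auto
  then have R1_lin: "R1 \<subseteq> lin V" unfolding R1_def by blast
  \<comment> \<open>Subtracting \<open>r\<close> turns the point back into its offset;
    \<open>C\<close> collects the changes that persist along no root function.\<close>
  define C where "C s \<longleftrightarrow> B s \<and> (\<forall>r\<in>R0. \<not> \<Phi> r (s(x := - r s + s x)))" for s
  have C: "dpred M C"
  proof -
    have "dpred M (\<lambda>s. \<Phi> r (s(x := - r s + s x)))" if "r \<in> R0" for r
      using that R0(2) lin_scale[of r V "-1"] by (intro dpred_shear[OF \<Phi> _ V]) auto
    then show ?thesis unfolding C_def by (intro dpred_conj B dpred_ball R0(1) dpred_neg)
  qed
  have C_supp: "supported (insert x V) C"
  proof -
    have C_imp: "C t" if s: "C s" and st: "\<And>i. i \<in> insert x V \<Longrightarrow> s i = t i" for s t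
      unfolding C_def
    proof (intro conjI ballI notI)
      have "B s = B t" by (rule supportedD[OF B_supp]) (rule st)
      then show "B t" using s unfolding C_def by blast
      fix r assume r: "r \<in> R0" "\<Phi> r (t(x := - r t + t x))"
      have "r s = r t" using r(1) R0(2) st by (intro lin_cong[of r V]) auto
      then have "\<Phi> r (s(x := - r s + s x))"
        using st by (intro \<Phi>_I[OF r(1) r(2)]) auto
      then show False using s r(1) unfolding C_def by blast
    qed
    show ?thesis unfolding supported_def using C_imp by (metis (no_types, lifting))
  qed
  define D where "D s \<longleftrightarrow> (\<exists>a. C (s(x := a)))" for s
  have D: "dpred M D" unfolding D_def by (rule dpred_ex[OF C])
  have D_supp: "supported V D"
  proof -
    have "C (s(x := a)) = C (t(x := a))" if "\<forall>i\<in>V. s i = t i" for s t a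
      by (rule supportedD[OF C_supp]) (use that in auto)
    then show ?thesis unfolding supported_def D_def by blast
  qed
  \<comment> \<open>Changes along \<open>x = r + q\<close> form a predicate in \<open>V\<close>,
    semilinear by the induction hypothesis. Over a generic point a change therefore persists nearby,
    which \<open>C\<close> excludes.\<close>
  have D_generic: "\<not> D t" if t: "generic V t" for t
  proof
    assume "D t"
    then obtain a where a: "C (t(x := a))" unfolding D_def by blast
    define s where "s = t(x := a)"
    have s: "C s" "B s" using a unfolding s_def C_def by blast+
    have gs: "generic V s" by (rule generic_cong[OF t]) (use V(2) in \<open>auto simp: s_def\<close>)
    obtain r where r: "r \<in> R0" "s x - r s \<in> \<rat>" using R0(3)[of s] s(2) unfolding B_def by blast
    define q where "q = s x - r s"
    have e: "(\<lambda>u. r u + q) \<in> lin V" using r R0(2) unfolding q_def by (intro lin_add lin_const) auto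
    have "dpred M (\<lambda>u. B (u(x := r u + q)))" by (rule dpred_lin_subst[OF affine B e V])
    moreover have "supported V (\<lambda>u. B (u(x := r u + q)))"
    proof -
      have "B (u(x := r u + q)) = B (v(x := r v + q))" if "\<forall>i\<in>V. u i = v i" for u v
      proof -
        have "r u = r v" using r(1) R0(2) that by (intro lin_cong[of r V]) auto
        then show ?thesis using that by (intro supportedD[OF B_supp]) auto
      qed
      then show ?thesis unfolding supported_def by blast
    qed
    ultimately have "sl V (\<lambda>u. B (u(x := r u + q)))" using IH[OF V(1)] by simp
    from sl_nearby_generic[OF V(1) this gs]
    have "nearby V s (\<lambda>u. B (u(x := r u + q)) = B (s(x := r s + q)))" .
    moreover have "B (s(x := r s + q))" using s(2) unfolding q_def by simp
    ultimately have "nearby V s (\<lambda>u. B (u(x := r u + q)))" by simp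
    then obtain d where d: "d > 0"
      "\<forall>u. (\<forall>i\<in>V. \<bar>u i - s i\<bar> < d) \<longrightarrow> (\<forall>i. i \<notin> V \<longrightarrow> u i = s i) \<longrightarrow> B (u(x := r u + q))"
      by (rule nearbyE)
    have "\<Phi> r (s(x := q))" unfolding \<Phi>_def
    proof (rule nearbyI[OF d(1)])
      fix u assume u: "\<And>i. i \<in> V \<Longrightarrow> \<bar>u i - (s(x := q)) i\<bar> < d" "\<And>i. i \<notin> V \<Longrightarrow> u i = (s(x := q)) i"
      have V_x: "i \<noteq> x" if "i \<in> V" for i using that V(2) by blast
      \<comment> \<open>The neighbourhood of \<open>s\<close> freezes \<open>x\<close> at
        \<open>s x\<close>, that of \<open>s(x := q)\<close> at \<open>q\<close>; the coordinate is
        reset before the former is used.\<close>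
      have "B ((u(x := s x))(x := r (u(x := s x)) + q))"
        by (rule d(2)[rule_format]) (use u V_x in \<open>auto split: if_splits\<close>)
      then show "B (u(x := r u + u x))" using r_upd[OF r(1)] u(2)[OF V(2)] by simp
    qed
    then show False using s(1) r(1) unfolding C_def q_def by simp
  qed
  obtain G where G: "finite G" "G \<subseteq> lin V" "\<And>g. g \<in> G \<Longrightarrow> \<exists>t. g t \<noteq> 0"
    "\<And>s. D s \<Longrightarrow> \<exists>g\<in>G. g s = 0"
    by (rule sl_no_generic[OF V(1) IH[OF V(1) order_refl D D_supp] D_generic], assumption, rule that)
  have "\<exists>R\<subseteq>lin V. finite R \<and> (\<forall>s. C s \<longrightarrow> g s = 0 \<longrightarrow> (\<exists>r\<in>R. s x = r s))" if g: "g \<in> G" for g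
  proof (cases "\<exists>s. g s = 0")
    case True
    then obtain s0 where "g s0 = 0" by blast
    moreover obtain t0 where "g t0 \<noteq> 0" using G(3)[OF g] by blast
    moreover have "g \<in> lin V" using g G(2) by blast
    ultimately obtain j e where je: "j \<in> V" "e \<in> lin (V - {j})" "\<And>u. g u = 0 \<longleftrightarrow> u j = e u"
      using lin_solve[of g V s0 t0] V(1) by metis
    have jx: "j \<noteq> x" using je(1) V(2) by blast
    \<comment> \<open>On the hyperplane \<open>g = 0\<close> the variable \<open>j\<close> is a form
      in the others of \<open>V\<close>. Eliminating it trades \<open>j\<close> for
      \<open>x\<close>, so the number of variables is at most that of \<open>V\<close> and the
      induction hypothesis covers a predicate that still involves \<open>x\<close>.\<close>
    let ?F = "\<lambda>s. C (s(j := e s))"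
    have F: "dpred M ?F" using V(1) by (intro dpred_lin_subst[OF affine C je(2)]) auto
    have F_supp: "supported (insert x (V - {j})) ?F"
    proof -
      have "?F u = ?F v" if "\<forall>i\<in>insert x (V - {j}). u i = v i" for u v
      proof -
        have "e u = e v" using that by (intro lin_cong[OF je(2)]) auto
        then show ?thesis using that by (intro supportedD[OF C_supp]) auto
      qed
      then show ?thesis unfolding supported_def by blast
    qed
    have fin: "finite (V - {j})" "x \<notin> V - {j}" using V by auto
    have "card (insert x (V - {j})) \<le> card V"
      using V card_Suc_Diff1[OF V(1) je(1)] by simp
    then have sl_F: "sl (insert x (V - {j})) ?F" using IH[OF _ _ F F_supp] V(1) by simp
    obtain R where R: "finite R" "R \<subseteq> lin (V - {j})"
      "\<And>s. \<not> (\<forall>\<^sub>F y in nhds (s x). ?F (s(x := y)) = ?F s) \<Longrightarrow> \<exists>r\<in>R. s x = r s"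
      by (rule sl_fiber_roots[OF fin sl_F], rule that)
    have "\<exists>r\<in>R. s x = r s" if s: "C s" "g s = 0" for s
    proof (rule R(3), rule notI)
      \<comment> \<open>If \<open>C\<close> were stable at \<open>s x\<close>, an entire interval
        would consist of changes of \<open>P\<close>, although on each line these lie in a countable
        set.\<close>
      assume ev: "\<forall>\<^sub>F y in nhds (s x). ?F (s(x := y)) = ?F s"
      have sj: "s j = e s" using s(2) je(3) by blast
      have e_upd: "e (s(x := y)) = e s" for y using V(2) by (intro lin_upd[OF je(2)]) auto
      have "(s(x := y))(j := e (s(x := y))) = s(x := y)" for y
        using sj jx unfolding e_upd by (auto simp: fun_eq_iff)
      moreover have "s(j := e s) = s" using sj by auto
      ultimately have "\<forall>\<^sub>F y in nhds (s x). C (s(x := y))" using ev s(1) by simp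
      then obtain d where d: "d > 0" "\<And>y. dist y (s x) < d \<Longrightarrow> C (s(x := y))"
        unfolding eventually_nhds_metric by blast
      have "countable (\<Union>r\<in>R0. (\<lambda>q. r s + q) ` \<rat>)"
        using R0(1) by (intro countable_UN countable_image countable_rat) (simp add: countable_finite)
      then obtain y where y: "s x < y" "y < s x + d" "y \<notin> (\<Union>r\<in>R0. (\<lambda>q. r s + q) ` \<rat>)"
        by (rule avoid_countable[of _ "s x" "s x + d"]) (use d(1) in auto)
      have "C (s(x := y))" using y(1,2) by (intro d(2)) (simp add: dist_real_def)
      then have "\<not> fibre_stable x P (s(x := y))" unfolding C_def B_def by blast
      then obtain r where r: "r \<in> R0" "y - r s \<in> \<rat>" using R0_upd by blast
      have "y = r s + (y - r s)" by simp
      with r y(3) show False by blast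
    qed
    moreover have "R \<subseteq> lin V" using R(2) lin_mono[of _ "V - {j}" V] V(1) by blast
    ultimately show ?thesis using R(1) by blast
  next
    case False
    then show ?thesis by blast
  qed
  then obtain R2 where R2: "\<And>g. g \<in> G \<Longrightarrow> R2 g \<subseteq> lin V" "\<And>g. g \<in> G \<Longrightarrow> finite (R2 g)"
    "\<And>g. g \<in> G \<Longrightarrow> \<forall>s. C s \<longrightarrow> g s = 0 \<longrightarrow> (\<exists>r\<in>R2 g. s x = r s)"
    by metis
  show ?thesis
  proof (rule that[of "R1 \<union> (\<Union>g\<in>G. R2 g)"])
    show "finite (R1 \<union> (\<Union>g\<in>G. R2 g))" using R1 G(1) R2(2) by blast
    show "R1 \<union> (\<Union>g\<in>G. R2 g) \<subseteq> lin V" using R1_lin R2(1) by blast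
    fix s assume "\<not> fibre_stable x P s"
    then have Bs: "B s" unfolding B_def .
    show "\<exists>r\<in>R1 \<union> (\<Union>g\<in>G. R2 g). s x = r s"
    proof (cases "C s")
      case True
      then have "D s" unfolding D_def by (intro exI[of _ "s x"]) simp
      then obtain g where g: "g \<in> G" "g s = 0" using G(4) by blast
      then obtain r where "r \<in> R2 g" "s x = r s" using R2(3)[OF g(1)] True by blast
      with g(1) show ?thesis by blast
    next
      case False
      then obtain r where r: "r \<in> R0" "\<Phi> r (s(x := - r s + s x))" using Bs unfolding C_def by blast
      then have "- r s + s x \<in> I r" unfolding I_def
        by (intro CollectI exI[of _ "s(x := - r s + s x)"]) simp
      then have "(\<lambda>u. r u + (- r s + s x)) \<in> R1" using r(1) unfolding R1_def by blast
      then show ?thesis by (intro bexI[of _ "\<lambda>u. r u + (- r s + s x)"]) auto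
    qed
  qed
qed

text \<open>Splitting off one variable \<open>x\<close>, the induction hypothesis serves twice:
  inside \<open>change_roots\<close>, and for the sample substitutions that
  \<open>sl_from_roots\<close> needs.\<close>

lemma dpred_sl:
  "finite W \<Longrightarrow> dpred M P \<Longrightarrow> supported W P \<Longrightarrow> sl W P"
proof (induction "card W" arbitrary: W P rule: less_induct)
  case less
  show ?case
  proof (cases "W = {}")
    case True
    then have "P s = P t" for s t using less.prems(3) by (auto simp: supported_def)
    then have "P = (\<lambda>s. P undefined)" by (intro ext)
    then show ?thesis by (metis sl_const)
  next
    case False
    then obtain x where x: "x \<in> W" by blast
    define V where "V = W - {x}"
    have V: "finite V" "x \<notin> V" and W: "W = insert x V" using x less.prems(1) by (auto simp: V_def)
    have "card V < card W" unfolding W using V by simp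
    then have IH: "sl U F" if "finite U" "card U \<le> card V" "dpred M F" "supported U F" for U F
      using less.hyps[of U F] that by simp
    have P: "supported (insert x V) P" using less.prems(3) W by simp
    obtain R where R: "finite R" "R \<subseteq> lin V" "\<And>s. \<not> fibre_stable x P s \<Longrightarrow> \<exists>r\<in>R. s x = r s"
      by (rule change_roots[OF V less.prems(2) P IH], assumption+, rule that)
    have "sl V (\<lambda>s. P (s(x := e s)))" if e: "e \<in> lin V" for e
    proof (rule IH[OF V(1) order_refl])
      show "dpred M (\<lambda>s. P (s(x := e s)))" by (rule dpred_lin_subst[OF affine less.prems(2) e V])
      have "P (u(x := e u)) = P (v(x := e v))" if "\<forall>i\<in>V. u i = v i" for u v
      proof -
        have "e u = e v" using that by (intro lin_cong[OF e]) auto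
        then show ?thesis using that by (intro supportedD[OF P]) auto
      qed
      then show "supported V (\<lambda>s. P (s(x := e s)))" unfolding supported_def by blast
    qed
    from sl_from_roots[OF V P R this] show ?thesis unfolding W .
  qed
qed

end

theorem theorem7p1:
  fixes n :: nat and X :: "real list set"
  assumes "n \<ge> 1"
    and "X \<subseteq> tuples n"
    and "definable real_plus_less_int n X"
    and "\<not> definable real_plus_less_one n X"
  shows "definable (real_plus_less_one_set n X) 1 int_rel"
proof (rule ccontr)
  define M where "M = real_plus_less_one_set n X"
  let ?P = "\<lambda>s. map s [0..<n] \<in> X"
  assume n: "\<not> ?thesis"
  have rels_M: "rels M = [Less \<mapsto> less_interp, SetPred \<mapsto> (n, X)]"
    unfolding M_def real_plus_less_one_set_def real_plus_less_one_def by simp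
  have fns_M: "fns M = fns real_plus_less_one_int"
    unfolding M_def real_plus_less_one_set_def real_plus_less_one_def real_plus_less_one_int_def by simp
  have P: "dpred real_plus_less_one_int ?P"
    using assms(3) by (intro dpred_real_plus_less_int) (simp add: definable_iff_dpred)
  have "intermediate M"
  proof
    show affine: "affine_structure M"
      unfolding affine_structure_def rels_M fns_M by (simp add: real_plus_less_one_int_def)
    \<comment> \<open>\<open>X\<close> is definable from the integers, so replacing its symbol by
      that definition keeps every predicate within the integer structure.\<close>
    show "dpred real_plus_less_one_int Q" if "dpred M Q" for Q
    proof (rule dpred_interpret[OF fns_M _ that])
      fix r m R assume r: "rels M r = Some (m, R)"
      show "dpred real_plus_less_one_int (\<lambda>s. map s [0..<m] \<in> R)"
      proof (cases "r = SetPred")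
        case True
        then show ?thesis using r P by (simp add: rels_M)
      next
        case False
        then have "rels real_plus_less_one_int r = Some (m, R)"
          using r by (simp add: rels_M real_plus_less_one_int_def split: if_splits)
        then show ?thesis by (rule dpred_rel)
      qed
    qed
    show "\<not> dpred M (\<lambda>s. s 0 \<in> \<int>)"
    proof
      assume "dpred M (\<lambda>s. s 0 \<in> \<int>)"
      moreover have "map s [0..<1] \<in> int_rel \<longleftrightarrow> s 0 \<in> \<int>" for s :: "nat \<Rightarrow> real"
        by (simp add: int_rel_def)
      ultimately have "definable M 1 int_rel"
        unfolding definable_iff_dpred by (simp add: int_rel_def tuples_def) auto
      with n show False unfolding M_def by contradiction
    qed
  qed
  then interpret intermediate M .
  have "dpred M ?P" using dpred_rel[of M SetPred n X] by (simp add: rels_M)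
  \<comment> \<open>Membership in \<open>X\<close> is itself one of the definable predicates of
    \<open>M\<close>; its semilinearity contradicts the choice of \<open>X\<close>.\<close>
  then have "sl {..<n} ?P" by (intro dpred_sl supported_map_upt) simp_all
  then have "dpred real_plus_less_one ?P"
    by (intro sl_dpred) (simp_all add: affine_structure_def real_plus_less_one_def)
  then have "definable real_plus_less_one n X" using assms(2) by (simp add: definable_iff_dpred)
  with assms(4) show False by contradiction
qed

end
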